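(* Let $\mathcal D$ be a regular set of ordered oriented virtual link diagrams, let $C''(\mathcal D)\subset C'(\mathcal D)$ be consistent subsets of $C(\mathcal D)$, let $G_1,G_2$ be abelian groups, let $v:C'(\mathcal D)\to G_1$ be an odd weight function and $w:C''(\mathcal D)\to G_2$ an even weight function. Let $L$ be an ordered oriented virtual link having a diagram in $\mathcal D$, and let $g\in G_2$ be such that $g\notin R(w,L)$ or $R(v,L)=\{0\}$. For a diagram $D$ of $L$ put $$I(D;v,w,g)=\sum_{c:\ w(c)=g} v(c),\qquad I_f(D;v,w,g)=\sum_{c:\ w(c)=g} v(c)+\sum_{c:\ w^*(c)=g} v^*(c),$$ where the sums run over crossings $c$ of $D$ lying in $C''(\mathcal D)$. Then: (i) $I(D;v,w,g)$ is an ordered oriented virtual link invariant; (ii) $I_f(D;v,w,g)$ is an ordered oriented flat virtual link invariant.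
   Context: Diagrams. A virtual link diagram is a 4-regular plane diagram of immersed oriented circles in which every vertex is marked as a classical crossing (with over/under information) or as a virtual crossing. It is ordered if its $n$ components are labelled by the integers $1,\dots,n$. Two ordered oriented diagrams are equivalent if they are related by finitely many generalized Reidemeister moves (respecting orientations and labels): the classical moves RI, RII, RIII; the virtual moves VRI, VRII, VRIII involving only virtual crossings; and the move SV, in which a strand having two virtual crossings with the two strands of a classical crossing is moved across that classical crossing. Ordered oriented virtual links are the equivalence classes. A crossing change switches over and under at one classical crossing. Ordered oriented flat virtual links are equivalence classes modulo generalized Reidemeister moves and crossing changes. A quantity is a (flat) virtual link invariant if it is unchanged under the corresponding moves. Regular sets. A set $\mathcal D$ of ordered oriented virtual link diagrams is regular if it is closed under generalized Reidemeister moves, crossing changes, reversing orientation and reordering of components. $C(D)$ is the set of classical crossings of $D$, and $C(\mathcal D)$ is the set of all classical crossings of all diagrams $D\in\mathcal D$. Weight functions. Let $G$ be an abelian group. A function $w:C(\mathcal D)\to G$ is a weight function if: (C1) $w$ is local: if $D'$ is obtained from $D$ by a generalized Reidemeister move in which the crossing $c$ of $D$ is not involved, and $c'$ is the corresponding crossing of $D'$, then $w(c')=w(c)$; (C2) if $D'$ is obtained from $D$ by an RIII move, each of the three crossings involved has the same weight as the corresponding crossing after the move; (C3) if $D'$ is obtained from $D$ by an SV move, the classical crossing involved has the same weight before and after the move. A weight function $w$ is odd (respectively even) if for any two classical crossings $\alpha,\beta$ involved in an RII move one has $w(\beta)=-w(\alpha)$ (respectively $w(\beta)=w(\alpha)$).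 A subset $C'(\mathcal D)\subset C(\mathcal D)$ is consistent if its characteristic function $C(\mathcal D)\to\{0,1\}\subset\mathbb Z$ is an even weight function. A weight function defined on a consistent subset $C'(\mathcal D)$ is a function $w:C'(\mathcal D)\to G$ satisfying (C1)–(C3) for all crossings in $C'(\mathcal D)$; it is odd (respectively even) if for any two classical crossings $\alpha,\beta\in C'(\mathcal D)$ involved in an RII move one has $w(\beta)=-w(\alpha)$ (respectively $w(\beta)=w(\alpha)$). Standing assumption: all weight functions are local with respect to crossing changes, i.e. if $D'$ is obtained from $D$ by a crossing change at $c_0$ and $c\ne c_0$, the weight of $c$ is the same in $D$ and $D'$. The domains are likewise unaffected by crossing changes. Mirror weights. $D^*$ is the diagram obtained from $D$ by changing all classical crossings, and $c^*\in C(D^* )$ is the crossing corresponding to $c\in C(D)$. For a weight function $w$, $w^*(c)=w(c^* )$. The sets $R$. For a weight function $w$ and a diagram $D$, $R(w,D)$ is the set of values $w(c)$ over the crossings $c$ of $D$ (in the domain of $w$) that can be removed by a single RI move; $R(w,L)$ is the union of the sets $R(w,D)$ over all diagrams $D\in\mathcal D$ of $L$. *)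

theory Defs
  imports Main
begin

text \<open>
  A generic immersion of oriented circles in the plane, with its double points marked, is recorded
  by reading the picture from bottom to top: after a small isotopy the height function has only
  non-degenerate critical points, no strand is horizontal at a crossing, and all minima, maxima and
  crossings lie on different heights. The picture is then the list of these events. An event at
  position \<open>i\<close> concerns the strands number \<open>i\<close> and \<open>i + 1\<close>, counted from the left starting with 0.

  A plane diagram has many such readings. Two readings present the same diagram up to isotopy of
  the plane iff they are connected by the rewriting steps of kind \<open>Iso\<close> below.
\<close>

text \<open>
  The strand that goes from the lower left to the upper right of a crossing is the slash, the other
  one the backslash; a classical crossing is given by the strand that passes over.
\<close>

datatype crossing_type = Virtual | Slash_Over | Backslash_Over

fun flip :: "crossing_type \<Rightarrow> crossing_type" where
  "flip Virtual = Virtual"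
| "flip Slash_Over = Backslash_Over"
| "flip Backslash_Over = Slash_Over"

text \<open>
  A strand carries the label of its component and its direction (\<open>True\<close> is upwards). In
  \<open>Min i l d\<close> the label of the new arc is \<open>l\<close> and \<open>d\<close> is the direction of its left leg.
\<close>

type_synonym strand = "nat \<times> bool"

datatype event = Min nat nat bool | Max nat | Cross nat crossing_type

type_synonym drawing = "event list"

fun apply_event :: "event \<Rightarrow> strand list \<Rightarrow> strand list option" where
  "apply_event (Min i l d) s =
     (if i \<le> length s then Some (take i s @ [(l, d), (l, \<not> d)] @ drop i s) else None)"
| "apply_event (Max i) s =
     (if i + 1 < length s \<and> fst (s ! i) = fst (s ! (i + 1)) \<and> snd (s ! i) \<noteq> snd (s ! (i + 1))
      then Some (take i s @ drop (i + 2) s) else None)"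
| "apply_event (Cross i t) s =
     (if i + 1 < length s then Some (take i s @ [s ! (i + 1), s ! i] @ drop (i + 2) s) else None)"

fun run :: "drawing \<Rightarrow> strand list \<Rightarrow> strand list option" where
  "run [] s = Some s"
| "run (e # D) s = (case apply_event e s of None \<Rightarrow> None | Some s' \<Rightarrow> run D s')"

definition level :: "drawing \<Rightarrow> nat \<Rightarrow> strand list" where
  "level D k = the (run (take k D) [])"

text \<open>
  The point \<open>(k, p)\<close> is strand number \<open>p\<close> at a height between the events \<open>k - 1\<close> and \<open>k\<close>.
\<close>

definition points :: "drawing \<Rightarrow> (nat \<times> nat) set" where
  "points D = {(k, p). k \<le> length D \<and> p < length (level D k)}"

definition point_label :: "drawing \<Rightarrow> nat \<times> nat \<Rightarrow> nat" where
  "point_label D x = fst (level D (fst x) ! snd x)"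

text \<open>
  \<open>passes e p q\<close>: strand \<open>p\<close> below the event \<open>e\<close> continues as strand \<open>q\<close> above it.
\<close>

fun passes :: "event \<Rightarrow> nat \<Rightarrow> nat \<Rightarrow> bool" where
  "passes (Min i l d) p q \<longleftrightarrow> p < i \<and> q = p \<or> i \<le> p \<and> q = p + 2"
| "passes (Max i) p q \<longleftrightarrow> p < i \<and> q = p \<or> i + 2 \<le> p \<and> p = q + 2"
| "passes (Cross i t) p q \<longleftrightarrow> q = (if p = i then i + 1 else if p = i + 1 then i else p)"

inductive joined :: "drawing \<Rightarrow> nat \<times> nat \<Rightarrow> nat \<times> nat \<Rightarrow> bool" for D where
  "k < length D \<Longrightarrow> D ! k = Min i l d \<Longrightarrow> joined D (k + 1, i) (k + 1, i + 1)"
| "k < length D \<Longrightarrow> D ! k = Max i \<Longrightarrow> joined D (k, i) (k, i + 1)"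
| "(k, p) \<in> points D \<Longrightarrow> k < length D \<Longrightarrow> passes (D ! k) p q \<Longrightarrow> joined D (k, p) (k + 1, q)"

text \<open>
  Ordered oriented virtual link diagrams: the picture closes up, the classes of connected points
  are the components (the immersed circles), and these are labelled by \<open>1, \<dots>, n\<close>.
\<close>

definition diagram :: "drawing \<Rightarrow> bool" where
  "diagram D \<longleftrightarrow> run D [] = Some [] \<and>
     (\<exists>n. point_label D ` points D = {1..n}) \<and>
     (\<forall>x \<in> points D. \<forall>y \<in> points D.
        point_label D x = point_label D y \<longleftrightarrow> equivclp (joined D) x y)"

fun classical_event :: "event \<Rightarrow> bool" where
  "classical_event (Cross i t) \<longleftrightarrow> t \<noteq> Virtual"
| "classical_event _ \<longleftrightarrow> False"

text \<open>A classical crossing is named by its index in the list of events.\<close>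

definition crossings :: "drawing \<Rightarrow> nat set" where
  "crossings D = {k. k < length D \<and> classical_event (D ! k)}"

definition all_crossings :: "drawing set \<Rightarrow> (drawing \<times> nat) set" where
  "all_crossings \<D> = {(D, k). D \<in> \<D> \<and> k \<in> crossings D}"


subsection \<open>Generalized Reidemeister moves\<close>

fun pos :: "event \<Rightarrow> nat" where
  "pos (Min i l d) = i"
| "pos (Max i) = i"
| "pos (Cross i t) = i"

fun shift :: "nat \<Rightarrow> event \<Rightarrow> event" where
  "shift m (Min i l d) = Min (i + m) l d"
| "shift m (Max i) = Max (i + m)"
| "shift m (Cross i t) = Cross (i + m) t"

fun strands_below :: "event \<Rightarrow> nat" where
  "strands_below (Min i l d) = 0"
| "strands_below (Max i) = 2"
| "strands_below (Cross i t) = 2"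

fun strands_above :: "event \<Rightarrow> nat" where
  "strands_above (Min i l d) = 2"
| "strands_above (Max i) = 0"
| "strands_above (Cross i t) = 2"

datatype move_kind = Iso | RI | RII | RIII | VRI | VRII | VRIII | SV

text \<open>
  The three strands of a triangle, from left to right at the bottom, are \<open>a\<close>, \<open>b\<close>, \<open>c\<close>; the types
  \<open>t1\<close>, \<open>t2\<close>, \<open>t3\<close> belong to the crossings \<open>ab\<close>, \<open>ac\<close>, \<open>bc\<close>. If all three are classical, the
  condition in the first line says that the over-relation on the strands is not cyclic.
\<close>

inductive triangle :: "move_kind \<Rightarrow> crossing_type \<Rightarrow> crossing_type \<Rightarrow> crossing_type \<Rightarrow> bool" where
  "t1 \<noteq> Virtual \<Longrightarrow> t2 \<noteq> Virtual \<Longrightarrow> t3 \<noteq> Virtual \<Longrightarrow> t2 = t1 \<or> t2 = t3 \<Longrightarrow> triangle RIII t1 t2 t3"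
| "triangle VRIII Virtual Virtual Virtual"
| "t \<noteq> Virtual \<Longrightarrow> triangle SV t Virtual Virtual"
| "t \<noteq> Virtual \<Longrightarrow> triangle SV Virtual t Virtual"
| "t \<noteq> Virtual \<Longrightarrow> triangle SV Virtual Virtual t"

text \<open>
  \<open>local_move m x y K\<close>: the fragment \<open>x\<close> may be replaced by \<open>y\<close> or conversely; \<open>K\<close> relates the
  indices of corresponding events of \<open>x\<close> and \<open>y\<close>. The first five rules (exchange of heights of two
  distant events, creation of a minimum and a maximum, a critical point passing through a crossing)
  generate the isotopies of the plane; because of them one position of the fragments in the plane
  is enough for each of the other moves. Labels and directions are forced by the requirement in
  \<open>move\<close> that both sides are diagrams.
\<close>

inductive local_move :: "move_kind \<Rightarrow> drawing \<Rightarrow> drawing \<Rightarrow> (nat \<times> nat) set \<Rightarrow> bool" where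
  exchange: "pos e \<le> pos f \<Longrightarrow>
    local_move Iso [e, shift (strands_above e) f] [shift (strands_below e) f, e] {(0, 1), (1, 0)}"
| zigzag_right: "local_move Iso [] [Min (i + 1) l d, Max i] {}"
| zigzag_left: "local_move Iso [] [Min i l d, Max (i + 1)] {}"
| rotate_max: "local_move Iso [Cross (i + 1) t, Max i] [Cross i (flip t), Max (i + 1)] {(0, 0)}"
| rotate_min:
    "local_move Iso [Min i l d, Cross (i + 1) t] [Min (i + 1) l d, Cross i (flip t)] {(1, 1)}"
| kink_right: "m = (if t = Virtual then VRI else RI) \<Longrightarrow>
    local_move m [] [Min (i + 1) l d, Cross i t, Max (i + 1)] {}"
| kink_left: "m = (if t = Virtual then VRI else RI) \<Longrightarrow>
    local_move m [] [Min i l d, Cross (i + 1) t, Max i] {}"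
| bigon: "m = (if t = Virtual then VRII else RII) \<Longrightarrow>
    local_move m [] [Cross i t, Cross i (flip t)] {}"
| triangle: "triangle m t1 t2 t3 \<Longrightarrow>
    local_move m [Cross i t1, Cross (i + 1) t2, Cross i t3]
      [Cross (i + 1) t3, Cross i t2, Cross (i + 1) t1] {(0, 2), (1, 1), (2, 0)}"

text \<open>
  \<open>move m u z x y K\<close>: the diagram \<open>u @ y @ z\<close> is obtained from the diagram \<open>u @ x @ z\<close> by a move
  of kind \<open>m\<close> that replaces \<open>x\<close> by \<open>y\<close>.
\<close>

definition move ::
  "move_kind \<Rightarrow> drawing \<Rightarrow> drawing \<Rightarrow> drawing \<Rightarrow> drawing \<Rightarrow> (nat \<times> nat) set \<Rightarrow> bool" where
  "move m u z x y K \<longleftrightarrow> (local_move m x y K \<or> local_move m y x (K\<inverse>)) \<and>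
     diagram (u @ x @ z) \<and> diagram (u @ y @ z)"

definition generalized_reidemeister :: "drawing \<Rightarrow> drawing \<Rightarrow> bool" where
  "generalized_reidemeister D D' \<longleftrightarrow>
     (\<exists>m u z x y K. move m u z x y K \<and> D = u @ x @ z \<and> D' = u @ y @ z)"

definition span :: "drawing \<Rightarrow> drawing \<Rightarrow> nat set" where
  "span u x = {length u ..< length u + length x}"

definition outer_corr :: "drawing \<Rightarrow> drawing \<Rightarrow> drawing \<Rightarrow> (nat \<times> nat) set" where
  "outer_corr u x y = {(k, k) | k. k < length u} \<union>
     {(length u + length x + k, length u + length y + k) | k. True}"

definition inner_corr :: "drawing \<Rightarrow> (nat \<times> nat) set \<Rightarrow> (nat \<times> nat) set" where
  "inner_corr u K = {(length u + a, length u + b) | a b. (a, b) \<in> K}"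

text \<open>
  Correspondence of the crossings not involved in a move. An isotopy involves no crossing at all.
\<close>

definition uninvolved_corr ::
  "move_kind \<Rightarrow> drawing \<Rightarrow> drawing \<Rightarrow> drawing \<Rightarrow> (nat \<times> nat) set \<Rightarrow> (nat \<times> nat) set" where
  "uninvolved_corr m u x y K = outer_corr u x y \<union> (if m = Iso then inner_corr u K else {})"


subsection \<open>Crossing changes, mirror images, reversal, reordering\<close>

fun flip_event :: "event \<Rightarrow> event" where
  "flip_event (Cross i t) = Cross i (flip t)"
| "flip_event e = e"

definition crossing_change :: "drawing \<Rightarrow> nat \<Rightarrow> drawing" where
  "crossing_change D k = D[k := flip_event (D ! k)]"

definition mirror :: "drawing \<Rightarrow> drawing" where
  "mirror D = map flip_event D"

fun relabel_event :: "(nat \<Rightarrow> nat) \<Rightarrow> event \<Rightarrow> event" where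
  "relabel_event \<pi> (Min i l d) = Min i (\<pi> l) d"
| "relabel_event \<pi> e = e"

fun reverse_event :: "event \<Rightarrow> event" where
  "reverse_event (Min i l d) = Min i l (\<not> d)"
| "reverse_event e = e"

definition regular :: "drawing set \<Rightarrow> bool" where
  "regular \<D> \<longleftrightarrow>
     (\<forall>D \<in> \<D>. diagram D) \<and>
     (\<forall>D \<in> \<D>. \<forall>D'. generalized_reidemeister D D' \<longrightarrow> D' \<in> \<D>) \<and>
     (\<forall>D \<in> \<D>. \<forall>k \<in> crossings D. crossing_change D k \<in> \<D>) \<and>
     (\<forall>D \<in> \<D>. map reverse_event D \<in> \<D>) \<and>
     (\<forall>D \<in> \<D>. \<forall>\<pi>. bij_betw \<pi> (point_label D ` points D) (point_label D ` points D) \<longrightarrow>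
        map (relabel_event \<pi>) D \<in> \<D>)"


subsection \<open>Virtual links and flat virtual links\<close>

definition virtual_equiv :: "drawing \<Rightarrow> drawing \<Rightarrow> bool" where
  "virtual_equiv = generalized_reidemeister\<^sup>*\<^sup>*"

definition flat_step :: "drawing \<Rightarrow> drawing \<Rightarrow> bool" where
  "flat_step D D' \<longleftrightarrow> generalized_reidemeister D D' \<or> (\<exists>k \<in> crossings D. D' = crossing_change D k)"

definition flat_equiv :: "drawing \<Rightarrow> drawing \<Rightarrow> bool" where
  "flat_equiv = flat_step\<^sup>*\<^sup>*"

definition virtual_links :: "drawing set set" where
  "virtual_links = {{D'. virtual_equiv D D'} | D. diagram D}"

definition virtual_link_invariant :: "drawing set \<Rightarrow> (drawing \<Rightarrow> 'a) \<Rightarrow> bool" where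
  "virtual_link_invariant L I \<longleftrightarrow> (\<forall>D \<in> L. \<forall>D'. virtual_equiv D D' \<longrightarrow> I D' = I D)"

text \<open>The diagrams \<open>D'\<close> below need not be diagrams of \<open>L\<close>, only of the same flat virtual link.\<close>

definition flat_virtual_link_invariant :: "drawing set \<Rightarrow> (drawing \<Rightarrow> 'a) \<Rightarrow> bool" where
  "flat_virtual_link_invariant L I \<longleftrightarrow> (\<forall>D \<in> L. \<forall>D'. flat_equiv D D' \<longrightarrow> I D' = I D)"


subsection \<open>Weight functions\<close>

text \<open>
  A weight function on \<open>A\<close>, a set of pairs of a diagram and a crossing of it, is a function on all
  pairs of which only the values on \<open>A\<close> matter.
\<close>

definition local_C1 :: "drawing set \<Rightarrow> (drawing \<times> nat) set \<Rightarrow> (drawing \<times> nat \<Rightarrow> 'g) \<Rightarrow> bool" where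
  "local_C1 \<D> A w \<longleftrightarrow>
     (\<forall>m u z x y K. u @ x @ z \<in> \<D> \<and> move m u z x y K \<longrightarrow>
        (\<forall>(c, c') \<in> uninvolved_corr m u x y K. (u @ x @ z, c) \<in> A \<and> (u @ y @ z, c') \<in> A \<longrightarrow>
           w (u @ y @ z, c') = w (u @ x @ z, c)))"

definition triangle_preserved ::
  "move_kind \<Rightarrow> drawing set \<Rightarrow> (drawing \<times> nat) set \<Rightarrow> (drawing \<times> nat \<Rightarrow> 'g) \<Rightarrow> bool" where
  "triangle_preserved m \<D> A w \<longleftrightarrow>
     (\<forall>u z x y K. u @ x @ z \<in> \<D> \<and> move m u z x y K \<longrightarrow>
        (\<forall>(c, c') \<in> inner_corr u K. (u @ x @ z, c) \<in> A \<and> (u @ y @ z, c') \<in> A \<longrightarrow>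
           w (u @ y @ z, c') = w (u @ x @ z, c)))"

definition local_crossing_change ::
  "drawing set \<Rightarrow> (drawing \<times> nat) set \<Rightarrow> (drawing \<times> nat \<Rightarrow> 'g) \<Rightarrow> bool" where
  "local_crossing_change \<D> A w \<longleftrightarrow>
     (\<forall>D \<in> \<D>. \<forall>k \<in> crossings D. \<forall>c \<in> crossings D - {k}.
        (D, c) \<in> A \<and> (crossing_change D k, c) \<in> A \<longrightarrow> w (crossing_change D k, c) = w (D, c))"

definition weight_function ::
  "drawing set \<Rightarrow> (drawing \<times> nat) set \<Rightarrow> (drawing \<times> nat \<Rightarrow> 'g::ab_group_add) \<Rightarrow> bool" where
  "weight_function \<D> A w \<longleftrightarrow>
     local_C1 \<D> A w \<and> triangle_preserved RIII \<D> A w \<and> triangle_preserved SV \<D> A w \<and>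
     local_crossing_change \<D> A w"

definition RII_pairs :: "drawing set \<Rightarrow> (drawing \<times> nat \<times> nat) set" where
  "RII_pairs \<D> = {(D, a, b). \<exists>u z x K. D = u @ x @ z \<and> D \<in> \<D> \<and> move RII u z x [] K \<and>
     a \<in> span u x \<and> b \<in> span u x \<and> a \<noteq> b}"

definition odd_weight_function ::
  "drawing set \<Rightarrow> (drawing \<times> nat) set \<Rightarrow> (drawing \<times> nat \<Rightarrow> 'g::ab_group_add) \<Rightarrow> bool" where
  "odd_weight_function \<D> A w \<longleftrightarrow> weight_function \<D> A w \<and>
     (\<forall>(D, a, b) \<in> RII_pairs \<D>. (D, a) \<in> A \<and> (D, b) \<in> A \<longrightarrow> w (D, b) = - w (D, a))"

definition even_weight_function ::
  "drawing set \<Rightarrow> (drawing \<times> nat) set \<Rightarrow> (drawing \<times> nat \<Rightarrow> 'g::ab_group_add) \<Rightarrow> bool" where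
  "even_weight_function \<D> A w \<longleftrightarrow> weight_function \<D> A w \<and>
     (\<forall>(D, a, b) \<in> RII_pairs \<D>. (D, a) \<in> A \<and> (D, b) \<in> A \<longrightarrow> w (D, b) = w (D, a))"

definition consistent :: "drawing set \<Rightarrow> (drawing \<times> nat) set \<Rightarrow> bool" where
  "consistent \<D> A \<longleftrightarrow> A \<subseteq> all_crossings \<D> \<and>
     even_weight_function \<D> (all_crossings \<D>) (\<lambda>x. of_bool (x \<in> A) :: int)"

text \<open>
  In contrast to \<open>local_crossing_change\<close> this includes the crossing that is changed; otherwise the
  mirror weight of a crossing in the domain would not always be defined.
\<close>

definition unaffected_by_crossing_changes :: "drawing set \<Rightarrow> (drawing \<times> nat) set \<Rightarrow> bool" where
  "unaffected_by_crossing_changes \<D> A \<longleftrightarrow>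
     (\<forall>D \<in> \<D>. \<forall>k \<in> crossings D. \<forall>c \<in> crossings D. (crossing_change D k, c) \<in> A \<longleftrightarrow> (D, c) \<in> A)"

definition mirror_weight :: "(drawing \<times> nat \<Rightarrow> 'g) \<Rightarrow> drawing \<times> nat \<Rightarrow> 'g" where
  "mirror_weight w = (\<lambda>(D, c). w (mirror D, c))"

definition RI_removable :: "drawing \<Rightarrow> nat set" where
  "RI_removable D = {c \<in> crossings D. \<exists>u z x K. D = u @ x @ z \<and> move RI u z x [] K \<and> c \<in> span u x}"

definition R_diagram ::
  "(drawing \<times> nat) set \<Rightarrow> (drawing \<times> nat \<Rightarrow> 'g) \<Rightarrow> drawing \<Rightarrow> 'g set" where
  "R_diagram A w D = {w (D, c) | c. c \<in> RI_removable D \<and> (D, c) \<in> A}"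

text \<open>
  As \<open>L\<close> contains all drawings of its diagrams, it does not matter that \<open>RI_removable\<close> refers to
  the standard position of a kink.
\<close>

definition R_link ::
  "drawing set \<Rightarrow> (drawing \<times> nat) set \<Rightarrow> (drawing \<times> nat \<Rightarrow> 'g) \<Rightarrow> drawing set \<Rightarrow> 'g set" where
  "R_link \<D> A w L = (\<Union>D \<in> L \<inter> \<D>. R_diagram A w D)"

text \<open>The argument \<open>A\<close> is the domain of \<open>w\<close>; it is contained in the domain of \<open>v\<close>.\<close>

definition weight_sum ::
  "(drawing \<times> nat) set \<Rightarrow> (drawing \<times> nat \<Rightarrow> 'g::ab_group_add) \<Rightarrow> (drawing \<times> nat \<Rightarrow> 'h) \<Rightarrow> 'h
     \<Rightarrow> drawing \<Rightarrow> 'g" where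
  "weight_sum A v w g D = (\<Sum>c \<in> {c \<in> crossings D. (D, c) \<in> A \<and> w (D, c) = g}. v (D, c))"

definition flat_weight_sum ::
  "(drawing \<times> nat) set \<Rightarrow> (drawing \<times> nat \<Rightarrow> 'g::ab_group_add) \<Rightarrow> (drawing \<times> nat \<Rightarrow> 'h) \<Rightarrow> 'h
     \<Rightarrow> drawing \<Rightarrow> 'g" where
  "flat_weight_sum A v w g D =
     weight_sum A v w g D + weight_sum A (mirror_weight v) (mirror_weight w) g D"

end

theory Submission
  imports Defs "HOL-Library.Nat_Bijection"
begin

text \<open>
  A move leaves the contributions of the crossings that it does not create or delete unchanged, two
  crossings of an RII move cancel because \<open>v\<close> is odd, and the crossing of an RI move contributes
  nothing by the assumption on \<open>g\<close>. A crossing change at \<open>k\<close> swaps the contributions of \<open>k\<close> to the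
  sums for \<open>D\<close> and \<open>D\<^sup>*\<close>. The difficulty in the flat case is that the assumption on \<open>g\<close> concerns
  only \<open>L\<close>, whereas the RI moves may occur in other virtual links of the same flat link. This is
  overcome by sliding kinks: a kink can be pushed along its whole component by moves that do not
  change its weights, because they involve its crossing only in isotopies and in moves RIII and SV.
  So the kink can be kept away from any other move or crossing change, and all virtual links of a
  flat class have the same sets of weights of removable crossings.

  The intermediate drawings must be diagrams, i.e. have the right labels on their components. For
  this, connectedness is replaced by a universal property of the labelling, which can be checked
  locally.
\<close>

subsection \<open>Running a drawing\<close>

text \<open>A strand that is pushed across a kink meets both strands at the crossing of the kink
  with one and the same type \<open>v\<close>. So the triangle that it passes is never cyclic: it is
  an RIII triangle if \<open>v\<close> is classical and an SV triangle if \<open>v\<close> is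
  virtual. At an extremum only isotopies occur, but the strand reverses there; hence a kink is
  described by its side with respect to the direction of its strand.

  A kink must also be able to leave a fragment that is about to be replaced. It can, because no
  fragment contains a whole component: every label in a fragment occurs on its boundary. The same
  fact keeps the set of labels fixed under moves.

  Paths through a replaced fragment would have to be rerouted case by case. With the universal
  property it is enough that a labelling of one side extends to the other side and is determined by
  its boundary. This is computed on three strands, except for the exchange of two events, where the
  events are arbitrary.

  The relation \<open>track\<close> is defined without weights, so that one route of a crossing
  transports \<open>v\<close>, \<open>w\<close> and both domains at once.\<close>

lemma run_append: "run (D @ E) s = (case run D s of None \<Rightarrow> None | Some s' \<Rightarrow> run E s')"
  by (induction D arbitrary: s) (auto split: option.splits)

lemma run_append_Some:
  "run (D @ E) s = Some r \<longleftrightarrow> (\<exists>s'. run D s = Some s' \<and> run E s' = Some r)"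
  by (auto simp: run_append split: option.splits)

lemma run_take: "run D s \<noteq> None \<Longrightarrow> run (take k D) s \<noteq> None"
  by (metis append_take_drop_id run_append option.simps(4))

lemma run_take_level: "run D [] \<noteq> None \<Longrightarrow> run (take k D) [] = Some (level D k)"
  using run_take[of D "[]" k] by (auto simp: level_def)

lemma level_Suc:
  assumes "run D [] \<noteq> None" "k < length D"
  shows "apply_event (D ! k) (level D k) = Some (level D (Suc k))"
proof -
  have "run (take k D @ [D ! k]) [] = Some (level D (Suc k))"
    using run_take_level[OF assms(1), of "Suc k"] assms(2) by (simp add: take_Suc_conv_app_nth)
  then show ?thesis
    using run_take_level[OF assms(1), of k] by (auto simp: run_append split: option.splits)
qed

lemma level_0 [simp]: "level D 0 = []"
  by (simp add: level_def)

lemma level_append: "k \<le> length u \<Longrightarrow> level (u @ z) k = level u k"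
  by (simp add: level_def)

lemma level_append_right:
  "run u [] = Some s \<Longrightarrow> level (u @ z) (length u + k) = the (run (take k z) s)"
  by (simp add: level_def run_append)

lemma passes_nth:
  assumes "apply_event e s = Some s'" "p < length s" "passes e p q"
  shows "q < length s' \<and> s' ! q = s ! p"
proof (cases e)
  case (Cross i t)
  then have "p < i \<or> p = i \<or> p = i + 1 \<or> (\<exists>j. p = i + 2 + j)"
    by presburger
  then show ?thesis
    using assms Cross by (auto simp: nth_append min_def split: if_splits)
qed (use assms in \<open>auto simp: nth_append min_def Suc_diff_le split: if_splits\<close>)

lemma Min_nth:
  assumes "apply_event (Min i l d) s = Some s'"
  shows "i + 1 < length s' \<and> s' ! i = (l, d) \<and> s' ! (i + 1) = (l, \<not> d)"
  using assms by (auto simp: nth_append min_def split: if_splits)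

lemma Max_nth:
  assumes "apply_event (Max i) s = Some s'"
  shows "i + 1 < length s \<and> fst (s ! i) = fst (s ! (i + 1)) \<and> snd (s ! i) \<noteq> snd (s ! (i + 1))"
  using assms by (auto split: if_splits)

lemma joined_points:
  assumes "run D [] \<noteq> None" "joined D a b"
  shows "a \<in> points D \<and> b \<in> points D \<and> point_label D a = point_label D b"
  using assms(2)
proof cases
  case (1 k i l d)
  then show ?thesis using Min_nth[of i l d "level D k" "level D (Suc k)"] level_Suc[OF assms(1), of k]
    by (auto simp: points_def point_label_def simp del: apply_event.simps)
next
  case (2 k i)
  then show ?thesis using Max_nth[of i "level D k" "level D (Suc k)"] level_Suc[OF assms(1), of k]
    by (auto simp: points_def point_label_def simp del: apply_event.simps)
next
  case (3 k p q)
  then show ?thesis using passes_nth[of "D ! k" _ _ p q] level_Suc[OF assms(1), of k]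
    by (auto simp: points_def point_label_def)
qed

lemma equivclp_joined_label:
  assumes "run D [] \<noteq> None" "equivclp (joined D) a b"
  shows "point_label D a = point_label D b"
  using assms(2)
  by (induction rule: equivclp_induct) (use joined_points[OF assms(1)] in auto)

subsection \<open>Relabelling\<close>

text \<open>A normal form up to labels: equal shapes mean that two drawings are labellings of one
  unlabelled picture. Only minima carry labels, and directions are kept.\<close>

abbreviation shape :: "drawing \<Rightarrow> drawing" where
  "shape \<equiv> map (relabel_event (\<lambda>_. 0))"

abbreviation relabel_strands :: "(nat \<Rightarrow> nat) \<Rightarrow> strand list \<Rightarrow> strand list" where
  "relabel_strands \<phi> \<equiv> map (apfst \<phi>)"

definition labels :: "drawing \<Rightarrow> nat set" where
  "labels D = {l. \<exists>i d. Min i l d \<in> set D}"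

lemma labels_simps [simp]:
  "labels [] = {}" "labels (D @ E) = labels D \<union> labels E" "labels (Min i l d # D) = insert l
      (labels D)"
  "labels (Max i # D) = labels D" "labels (Cross i t # D) = labels D"
  by (auto simp: labels_def)

lemma apply_event_relabel:
  assumes "apply_event e s = Some s'"
  shows "apply_event (relabel_event \<phi> e) (relabel_strands \<phi> s) = Some (relabel_strands \<phi> s')"
  using assms by (cases e) (auto simp: take_map drop_map split: if_splits)

lemma run_relabel:
  "run D s = Some s' \<Longrightarrow>
    run (map (relabel_event \<phi>) D) (relabel_strands \<phi> s) = Some (relabel_strands \<phi> s')"
proof (induction D arbitrary: s)
  case (Cons e D)
  then obtain s1 where "apply_event e s = Some s1" "run D s1 = Some s'"
    by (auto split: option.splits)
  then show ?case using Cons.IH apply_event_relabel[of e s s1 \<phi>] by simp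
qed auto

lemma relabel_event_comp: "relabel_event \<phi> (relabel_event \<psi> e) = relabel_event (\<phi> \<circ> \<psi>) e"
  by (cases e) auto

lemma shape_relabel [simp]: "shape (map (relabel_event \<phi>) D) = shape D"
  by (simp add: relabel_event_comp comp_def)

lemma run_shape_directions:
  assumes "run D s = Some r" "run D' s' = Some r'" "shape D' = shape D" "map snd s' = map snd s"
  shows "map snd r' = map snd r"
proof -
  \<comment> \<open>A strand whose label is 0 amounts to its direction.\<close>
  have *: "relabel_strands (\<lambda>_. 0) a = relabel_strands (\<lambda>_. 0) b \<longleftrightarrow> map snd a = map snd b"
    for a b :: "strand list"
  proof -
    have "apfst (\<lambda>_. 0::nat) = (Pair 0 \<circ> snd :: strand \<Rightarrow> strand)"
      by (auto simp: fun_eq_iff)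
    moreover have "inj (Pair (0::nat) :: bool \<Rightarrow> strand)" by (simp add: inj_def)
    ultimately show ?thesis
      by (metis inj_map_eq_map list.map_comp)
  qed
  show ?thesis
    using run_relabel[OF assms(1), of "\<lambda>_. 0"] run_relabel[OF assms(2), of "\<lambda>_. 0"] assms(3,4)
    by (simp flip: *)
qed

lemma shape_eq_nth: "shape D' = shape D \<Longrightarrow> k < length D \<Longrightarrow>
    relabel_event (\<lambda>_. 0) (D' ! k) = relabel_event (\<lambda>_. 0) (D ! k)"
  by (metis length_map nth_map)

lemma relabel_0_Min: "relabel_event (\<lambda>_. 0) e = Min i m d \<longleftrightarrow> m = 0 \<and> (\<exists>l. e = Min i l d)"
  and relabel_0_Max: "relabel_event (\<lambda>_. 0) e = Max i \<longleftrightarrow> e = Max i"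
  and relabel_0_Cross: "relabel_event (\<lambda>_. 0) e = Cross i t \<longleftrightarrow> e = Cross i t"
  by (cases e; auto)+

lemmas relabel_0_simps [simp] = relabel_0_Min relabel_0_Max relabel_0_Cross

lemma passes_shape:
  "relabel_event (\<lambda>_. 0) e = relabel_event (\<lambda>_. 0) e' \<Longrightarrow> passes e p q = passes e' p q"
  by (cases e; cases e') auto

text \<open>
  Connectedness of the components, restated without paths: the labels of \<open>D\<close> form the finest
  labelling that closes up.
\<close>

definition finest_labels :: "drawing \<Rightarrow> bool" where
  "finest_labels D \<longleftrightarrow>
     (\<forall>D'. shape D' = shape D \<and> run D' [] = Some [] \<longrightarrow> (\<exists>\<phi>. D' = map (relabel_event \<phi>) D))"

lemma shape_level_length:
  assumes "shape D' = shape D" "run D [] = Some []" "run D' [] = Some []"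
  shows "length (level D' k) = length (level D k)"
proof -
  have "shape (take k D') = shape (take k D)" using assms(1) by (simp flip: take_map)
  then have "map snd (level D' k) = map snd (level D k)"
    using run_shape_directions[of "take k D" "[]" "level D k" "take k D'" "[]" "level D' k"]
      run_take_level assms by auto
  then show ?thesis by (metis length_map)
qed

lemma joined_shape:
  assumes "shape D' = shape D" "run D [] = Some []" "run D' [] = Some []" "joined D a b"
  shows "joined D' a b"
  using assms(4)
proof cases
  case (1 k i l d)
  then obtain l' where "D' ! k = Min i l' d" using shape_eq_nth[OF assms(1), of k] by auto
  then show ?thesis using 1 map_eq_imp_length_eq[OF assms(1)] joined.intros(1)[of k D' i l' d] by simp
next
  case (2 k i)
  then show ?thesis using shape_eq_nth[OF assms(1), of k] map_eq_imp_length_eq[OF assms(1)]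
      joined.intros(2)[of k D' i] by simp
next
  case (3 k p q)
  then show ?thesis
    using shape_eq_nth[OF assms(1), of k] map_eq_imp_length_eq[OF assms(1)]
      passes_shape[of "D' ! k" "D ! k" p q]
      shape_level_length[OF assms(1-3)] joined.intros(3)[of k p D' q]
    by (simp add: points_def)
qed

lemma equivclp_mono:
  assumes "\<And>a b. R a b \<Longrightarrow> equivclp S a b" "equivclp R a b"
  shows "equivclp S a b"
  using assms(2)
proof (induction rule: equivclp_induct)
  case (step b c)
  then have "equivclp S b c" using assms(1)[of b c] equivclp_sym[OF assms(1)[of c b]] by auto
  then show ?case using step.IH by (rule equivclp_trans[rotated])
qed (simp add: equivclp_refl)

text \<open>The relation \<open>joined\<close> depends only on the shape, so every component of
  \<open>D\<close> is also connected in \<open>D'\<close>, where labels are constant along strands.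
  Hence the label in \<open>D'\<close> is a function of the label in \<open>D\<close>.\<close>

lemma diagram_finest_labels:
  assumes "diagram D"
  shows "finest_labels D"
  unfolding finest_labels_def
proof (intro allI impI)
  fix D' assume D': "shape D' = shape D \<and> run D' [] = Some []"
  have ok: "run D [] = Some []" using assms by (auto simp: diagram_def)
  have same: "point_label D' a = point_label D' b"
    if "a \<in> points D" "b \<in> points D" "point_label D a = point_label D b" for a b
  proof -
    have "equivclp (joined D) a b" using assms that by (auto simp: diagram_def)
    then have "equivclp (joined D') a b"
      using joined_shape[of D' D] D' ok by (elim equivclp_mono[rotated]) auto
    then show ?thesis using equivclp_joined_label[of D'] D' by auto
  qed
  \<comment> \<open>The value at \<open>l\<close> is read off at any point with label
    \<open>l\<close>; by \<open>same\<close> the choice does not matter.\<close>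
  define \<phi> where "\<phi> l = point_label D' (SOME a. a \<in> points D \<and> point_label D a = l)" for l
  have \<phi>: "\<phi> (point_label D a) = point_label D' a" if "a \<in> points D" for a
  proof -
    define b where "b = (SOME b. b \<in> points D \<and> point_label D b = point_label D a)"
    have "b \<in> points D \<and> point_label D b = point_label D a"
      unfolding b_def by (rule someI[of _ a]) (use that in auto)
    then have "point_label D' b = point_label D' a" using that by (intro same) auto
    then show ?thesis by (simp add: \<phi>_def b_def)
  qed
  have "D' = map (relabel_event \<phi>) D"
  proof (rule nth_equalityI)
    show len: "length D' = length (map (relabel_event \<phi>) D)" using D' map_eq_imp_length_eq by
        fastforce
    fix k assume "k < length D'"
    then have k: "k < length D" "k < length D'" using len by auto
    note sh = shape_eq_nth[OF conjunct1[OF D'] k(1)]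
    show "D' ! k = map (relabel_event \<phi>) D ! k"
    proof (cases "D ! k")
      case (Min i l d)
      then obtain l' where l': "D' ! k = Min i l' d" using sh by auto
      have "(Suc k, i) \<in> points D" "point_label D (Suc k, i) = l" "point_label D' (Suc k, i) = l'"
        using Min_nth[of i l d "level D k" "level D (Suc k)"] Min_nth[of i l' d "level D' k" "level
            D' (Suc k)"]
          level_Suc[of D k] level_Suc[of D' k] ok D' k Min l'
        by (auto simp: points_def point_label_def simp del: apply_event.simps)
      then show ?thesis using \<phi>[of "(Suc k, i)"] k Min l' by simp
    qed (use sh k in auto)
  qed
  then show "\<exists>\<phi>. D' = map (relabel_event \<phi>) D" by blast
qed

text \<open>A function that is constant along strands is itself a labelling: each minimum takes its
  label from its left leg, constancy carries it upwards, and at a maximum it makes the two ends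
  agree. This turns a partition of the points into a competitor for
  \<open>finest_labels\<close>.\<close>

lemma run_recolour:
  fixes f :: "nat \<times> nat \<Rightarrow> nat"
  assumes ok: "run D [] = Some []"
    and f: "\<And>a b. joined D a b \<Longrightarrow> f a = f b"
  defines "D' \<equiv> map (\<lambda>k. case D ! k of Min i l d \<Rightarrow> Min i (f (k + 1, i)) d | e \<Rightarrow> e) [0..<length D]"
    and "col \<equiv> \<lambda>k. map (\<lambda>p. (f (k, p), snd (level D k ! p))) [0..<length (level D k)]"
  assumes "k \<le> length D"
  shows "run (take k D') [] = Some (col k)"
  using assms(5)
proof (induction k)
  case 0
  then show ?case by (simp add: col_def)
next
  case (Suc k)
  have k: "k < length D" "k < length D'" using Suc by (auto simp: D'_def)
  let ?s = "level D k" let ?s' = "level D (Suc k)"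
  have app: "apply_event (D ! k) ?s = Some ?s'" using level_Suc ok k by simp
  have thru: "f (Suc k, q) = f (k, p)" if "p < length ?s" "passes (D ! k) p q" for p q
    using f[OF joined.intros(3)[of k p D q]] k that by (auto simp: points_def)
  have key: "apply_event (D' ! k) (col k) = Some (col (Suc k))"
  proof (cases "D ! k")
    case (Min i l d)
    have D'k: "D' ! k = Min i (f (Suc k, i)) d" using k Min by (simp add: D'_def)
    have i: "i \<le> length ?s" and s': "?s' = take i ?s @ [(l, d), (l, \<not> d)] @ drop i ?s"
      using app Min by (auto split: if_splits)
    have fi: "f (Suc k, i) = f (Suc k, Suc i)" using f[OF joined.intros(1)[of k D i l d]] k Min by simp
    have "take i (col k) @ [(f (Suc k, i), d), (f (Suc k, i), \<not> d)] @ drop i (col k) = col (Suc k)"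
    proof (rule nth_equalityI)
      show "length (take i (col k) @ [(f (Suc k, i), d), (f (Suc k, i), \<not> d)] @ drop i (col k)) =
        length (col (Suc k))" using i s' by (simp add: col_def)
      fix q assume "q < length (take i (col k) @ [(f (Suc k, i), d), (f (Suc k, i), \<not> d)] @ drop
          i (col k))"
      then have q: "q < length ?s + 2" using i by (simp add: col_def)
      have "q < i \<or> q = i \<or> q = Suc i \<or> (\<exists>j. q = i + 2 + j)" by presburger
      then consider "q < i" | "q = i" | "q = Suc i" | j where "q = i + 2 + j" "i + j < length ?s"
        using q by auto
      then show "(take i (col k) @ [(f (Suc k, i), d), (f (Suc k, i), \<not> d)] @ drop i (col k)) ! q =
        col (Suc k) ! q"
        using i s' fi thru[of q q] thru[of "q - 2" q] Min
        by cases (auto simp: col_def nth_append min_def simp del: upt_Suc)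
    qed
    then show ?thesis using D'k i by (simp add: col_def)
  next
    case (Max i)
    have D'k: "D' ! k = Max i" using k Max by (simp add: D'_def)
    have i: "i + 1 < length ?s" "snd (?s ! i) \<noteq> snd (?s ! (i + 1))" and s': "?s' = take i ?s @
        drop (i + 2) ?s"
      using app Max by (auto split: if_splits)
    have fi: "f (k, i) = f (k, Suc i)" using f[OF joined.intros(2)[of k D i]] k Max by simp
    have "take i (col k) @ drop (i + 2) (col k) = col (Suc k)"
    proof (rule nth_equalityI)
      show "length (take i (col k) @ drop (i + 2) (col k)) = length (col (Suc k))"
        using i s' by (simp add: col_def)
      fix q assume "q < length (take i (col k) @ drop (i + 2) (col k))"
      then have q: "q + 2 < length ?s" using i by (simp add: col_def)
      then show "(take i (col k) @ drop (i + 2) (col k)) ! q = col (Suc k) ! q"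
        using i s' thru[of q q] thru[of "q + 2" q] Max
        by (cases "q < i") (auto simp: col_def nth_append min_def)
    qed
    then show ?thesis using D'k i fi by (simp add: col_def)
  next
    case (Cross i t)
    have D'k: "D' ! k = Cross i t" using k Cross by (simp add: D'_def)
    have i: "i + 1 < length ?s" and s': "?s' = take i ?s @ [?s ! (i + 1), ?s ! i] @ drop (i + 2) ?s"
      using app Cross by (auto split: if_splits)
    have "take i (col k) @ [col k ! (i + 1), col k ! i] @ drop (i + 2) (col k) = col (Suc k)"
    proof (rule nth_equalityI)
      show "length (take i (col k) @ [col k ! (i + 1), col k ! i] @ drop (i + 2) (col k)) = length
          (col (Suc k))"
        using i s' by (simp add: col_def)
      fix q assume "q < length (take i (col k) @ [col k ! (i + 1), col k ! i] @ drop (i + 2) (col k))"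
      then have q: "q < length ?s" using i by (simp add: col_def)
      have "q < i \<or> q = i \<or> q = Suc i \<or> (\<exists>j. q = i + 2 + j)" by presburger
      then consider "q < i" | "q = i" | "q = Suc i" | j where "q = i + 2 + j" by blast
      then show "(take i (col k) @ [col k ! (i + 1), col k ! i] @ drop (i + 2) (col k)) ! q = col
          (Suc k) ! q"
        using i q s' thru[of q q] thru[of "q - 1" q] thru[of "q + 1" q] Cross
        by cases (auto simp: col_def nth_append min_def simp del: upt_Suc)
    qed
    then show ?thesis using D'k i by (simp add: col_def)
  qed
  show ?case using Suc key k by (simp add: take_Suc_conv_app_nth run_append)
qed

text \<open>Labelling every point by its connected component is one of the competitors, so the
  component of a point is a function of its label.\<close>

lemma finest_labels_connected:
  assumes ok: "run D [] = Some []" and fin: "finest_labels D"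
    and ab: "a \<in> points D" "b \<in> points D" "point_label D a = point_label D b"
  shows "equivclp (joined D) a b"
proof -
  \<comment> \<open>Labels are natural numbers, so a component is named by the least code of a point
    in it.\<close>
  define f where "f a = (LEAST n. equivclp (joined D) a (prod_decode n))" for a
  have f: "equivclp (joined D) a (prod_decode (f a))" for a
    unfolding f_def by (rule LeastI[of _ "prod_encode a"]) (simp add: equivclp_refl)
  have f_eq: "f a = f b" if "equivclp (joined D) a b" for a b
  proof -
    have "equivclp (joined D) a c \<longleftrightarrow> equivclp (joined D) b c" for c
      using that equivclp_sym[OF that] by (auto intro: equivclp_trans)
    then show ?thesis by (simp add: f_def)
  qed
  define D' where
    "D' = map (\<lambda>k. case D ! k of Min i l d \<Rightarrow> Min i (f (k + 1, i)) d | e \<Rightarrow> e) [0..<length D]"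
  define col where "col k = map (\<lambda>p. (f (k, p), snd (level D k ! p))) [0..<length (level D
      k)]" for k
  have run: "run (take k D') [] = Some (col k)" if "k \<le> length D" for k
    unfolding D'_def col_def by (rule run_recolour[OF ok _ that]) (auto intro: f_eq)
  have "level D (length D) = []" using ok by (simp add: level_def)
  then have "run D' [] = Some []" using run[of "length D"] by (simp add: D'_def col_def)
  moreover have "shape D' = shape D"
    by (rule nth_equalityI) (auto simp: D'_def split: event.split)
  ultimately obtain \<phi> where \<phi>: "D' = map (relabel_event \<phi>) D"
    using fin by (auto simp: finest_labels_def)
  have *: "f x = \<phi> (point_label D x)" if "x \<in> points D" for x
  proof -
    obtain k p where x: "x = (k, p)" by (cases x)
    then have kp: "k \<le> length D" "p < length (level D k)" using that by (auto simp: points_def)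
    have "run (take k D') [] = Some (relabel_strands \<phi> (level D k))"
      using run_relabel[OF run_take_level[of D k], of \<phi>] ok by (simp add: \<phi> take_map)
    then have "col k = relabel_strands \<phi> (level D k)" using run[OF kp(1)] by simp
    then have "fst (col k ! p) = fst (relabel_strands \<phi> (level D k) ! p)" by simp
    then show ?thesis using kp by (simp add: col_def x point_label_def)
  qed
  have "f a = f b" using * ab by simp
  then show ?thesis using f[of a] f[of b] by (metis equivclp_sym equivclp_trans)
qed

section \<open>Labels of strands and a path-free form of \<open>diagram\<close>\<close>

lemma apply_event_labels:
  assumes "apply_event e s = Some s'"
  shows "fst ` set s' \<subseteq> fst ` set s \<union> labels [e]"
proof -
  have "set s' \<subseteq> set s \<union> (labels [e] \<times> UNIV)"
    using assms by (cases e) (auto split: if_splits dest: in_set_takeD in_set_dropD)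
  then show ?thesis by force
qed

lemma labels_Cons: "labels (e # D) = labels [e] \<union> labels D"
  by (auto simp: labels_def)

lemma run_labels: "run D s = Some s' \<Longrightarrow> fst ` set s' \<subseteq> fst ` set s \<union> labels D"
proof (induction D arbitrary: s)
  case (Cons e D)
  then obtain s1 where "apply_event e s = Some s1" "run D s1 = Some s'" by (auto split: option.splits)
  then show ?case using Cons.IH apply_event_labels labels_Cons[of e D] by blast
qed auto

lemma labels_take: "labels (take k D) \<subseteq> labels D"
  by (auto simp: labels_def dest: in_set_takeD)

lemma labels_points:
  assumes ok: "run D [] = Some []"
  shows "point_label D ` points D = labels D"
proof
  show "point_label D ` points D \<subseteq> labels D"
  proof
    fix l assume "l \<in> point_label D ` points D"
    then obtain k p where "p < length (level D k)" "l = fst (level D k ! p)"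
      by (auto simp: points_def point_label_def)
    then have "l \<in> fst ` set (level D k)" by auto
    then show "l \<in> labels D"
      using run_labels[OF run_take_level[of D k]] ok labels_take by fastforce
  qed
  show "labels D \<subseteq> point_label D ` points D"
  proof
    fix l assume "l \<in> labels D"
    then obtain i d where "Min i l d \<in> set D" by (auto simp: labels_def)
    then obtain k where k: "k < length D" "D ! k = Min i l d" by (auto simp: in_set_conv_nth)
    then show "l \<in> point_label D ` points D"
      using Min_nth[of i l d "level D k" "level D (Suc k)"] level_Suc[of D k] ok
      by (intro image_eqI[of _ _ "(Suc k, i)"])
        (auto simp: points_def point_label_def simp del: apply_event.simps)
  qed
qed

text \<open>Without points and paths, a diagram can be recognised by what its fragments do to the
  strands on their boundaries.\<close>

lemma diagram_iff:
  "diagram D \<longleftrightarrow> run D [] = Some [] \<and> (\<exists>n. labels D = {1..n}) \<and> finest_labels D"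
proof
  assume "diagram D"
  then show "run D [] = Some [] \<and> (\<exists>n. labels D = {1..n}) \<and> finest_labels D"
    using diagram_finest_labels[of D] labels_points[of D] by (simp add: diagram_def)
next
  assume asm: "run D [] = Some [] \<and> (\<exists>n. labels D = {1..n}) \<and> finest_labels D"
  then have "\<forall>x\<in>points D. \<forall>y\<in>points D. point_label D x = point_label D y \<longleftrightarrow> equivclp (joined D) x y"
    using finest_labels_connected[of D] equivclp_joined_label[of D] by (metis option.distinct(1))
  then show "diagram D"
    using asm labels_points[of D] by (simp add: diagram_def)
qed

subsection \<open>Local moves preserve diagrams\<close>

text \<open>The effect of an event on just the strands that it touches, with the position stripped
  off. For distant events this separates the bookkeeping of positions from the kinds of the
  events.\<close>

fun acts :: "event \<Rightarrow> strand list \<Rightarrow> strand list \<Rightarrow> bool" where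
  "acts (Min i l d) q q' \<longleftrightarrow> q = [] \<and> q' = [(l, d), (l, \<not> d)]"
| "acts (Max i) q q' \<longleftrightarrow> (\<exists>l d. q = [(l, d), (l, \<not> d)]) \<and> q' = []"
| "acts (Cross i t) q q' \<longleftrightarrow> (\<exists>a b. q = [a, b] \<and> q' = [b, a])"

lemma acts_length: "acts e q q' \<Longrightarrow> length q = strands_below e \<and> length q' = strands_above e"
  by (cases e) auto

lemma acts_shift [simp]: "acts (shift n e) = acts e"
  by (cases e) (auto simp: fun_eq_iff)

lemma pos_shift [simp]: "pos (shift n e) = pos e + n"
  by (cases e) auto

lemma strands_shift [simp]:
  "strands_below (shift n e) = strands_below e" "strands_above (shift n e) = strands_above e"
  by (cases e; simp)+

lemma acts_labels: "acts e q q' \<Longrightarrow> labels [e] \<subseteq> fst ` set q'"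
  by (cases e) auto

lemma acts_shape_unique:
  "acts e q q' \<Longrightarrow> acts e' q q' \<Longrightarrow> relabel_event (\<lambda>_. 0) e' = relabel_event (\<lambda>_. 0) e \<Longrightarrow> e' = e"
  by (cases e) auto

lemma split_two: "i + 1 < length s \<Longrightarrow> s = take i s @ [s ! i, s ! (i + 1)] @ drop (i + 2) s"
  by (simp add: Cons_nth_drop_Suc)

lemma apply_event_acts:
  "apply_event e s = Some s' \<longleftrightarrow>
    (\<exists>p q q' t. s = p @ q @ t \<and> s' = p @ q' @ t \<and> length p = pos e \<and> acts e q q')" (is "?l = ?r")
proof
  assume l: ?l
  show ?r
  proof (cases e)
    case (Min i k d)
    with l show ?thesis
      by (intro exI[of _ "take i s"] exI[of _ "[]"] exI[of _ "[(k, d), (k, \<not> d)]"] exI[of _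
          "drop i s"])
        (auto split: if_splits)
  next
    case (Max i)
    with l have "i + 1 < length s" by (auto split: if_splits)
    with l Max split_two[of i s] show ?thesis
      by (intro exI[of _ "take i s"] exI[of _ "[s ! i, s ! (i + 1)]"] exI[of _ "[]"] exI[of _ "drop
          (i + 2) s"])
        (auto simp: prod_eq_iff split: if_splits)
  next
    case (Cross i k)
    with l have "i + 1 < length s" by (auto split: if_splits)
    with l Cross split_two[of i s] show ?thesis
      by (intro exI[of _ "take i s"] exI[of _ "[s ! i, s ! (i + 1)]"] exI[of _ "[s ! (i + 1), s ! i]"]
          exI[of _ "drop (i + 2) s"]) (auto split: if_splits)
  qed
next
  assume ?r
  then show ?l by (cases e) (auto simp: nth_append)
qed

section \<open>Exchange of two distant events\<close>

lemma append_eq_append_le: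
  "a @ b = c @ d \<Longrightarrow> length a \<le> length c \<Longrightarrow> \<exists>m. c = a @ m \<and> b = m @ d"
  by (auto simp: append_eq_append_conv2)

lemma shift_0 [simp]: "shift 0 e = e"
  by (cases e) auto

text \<open>The right-hand side is a normal form that does not mention the order of the events: the
  strands split into the strands of \<open>e\<close>, those of \<open>f\<close> and three untouched
  blocks. \<open>run_exchange_below\<close> reaches the same form, so the nine combinations of kinds
  need not be distinguished.\<close>

lemma run_exchange_above:
  assumes "pos e \<le> pos f"
  shows "run [e, shift (strands_above e) f] s = Some r \<longleftrightarrow>
    (\<exists>p q q' m g g' t. s = p @ q @ m @ g @ t \<and> r = p @ q' @ m @ g' @ t \<and> length p = pos e \<and>
      length p + length m = pos f \<and> acts e q q' \<and> acts f g g')" (is "?l = ?r")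
proof
  assume ?l
  then obtain s1 where "apply_event e s = Some s1" "apply_event (shift (strands_above e) f) s1 = Some r"
    by (auto split: option.splits)
  then obtain p q q' t1 p2 g g' t where *: "s = p @ q @ t1" "s1 = p @ q' @ t1" "length p = pos e"
      "acts e q q'"
    "s1 = p2 @ g @ t" "r = p2 @ g' @ t" "length p2 = pos f + strands_above e" "acts f g g'"
    unfolding apply_event_acts acts_shift pos_shift by blast
  have "(p @ q') @ t1 = p2 @ g @ t" using *(2,5) by simp
  \<comment> \<open>The shift by \<open>strands_above e\<close> puts \<open>f\<close> to the right
    of everything that \<open>e\<close> leaves behind.\<close>
  moreover have len: "length (p @ q') \<le> length p2" using *(3,7) acts_length[OF *(4)] assms by simp
  ultimately obtain m where m: "p2 = (p @ q') @ m" "t1 = m @ g @ t" using append_eq_append_le by blast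
  from m(1) have "length p + length m = pos f" using *(7) acts_length[OF *(4)] by simp
  with m show ?r using *(1,6,3,4,8)
    by (intro exI conjI) (assumption | simp only: append_assoc)+
next
  assume ?r
  then obtain p q q' m g g' t where *: "s = p @ q @ m @ g @ t" "r = p @ q' @ m @ g' @ t" "length p =
      pos e"
    "length p + length m = pos f" "acts e q q'" "acts f g g'" by blast
  have "apply_event e s = Some (p @ q' @ m @ g @ t)" using * by (auto simp: apply_event_acts)
  moreover have "apply_event (shift (strands_above e) f) (p @ q' @ m @ g @ t) = Some r"
    unfolding apply_event_acts using * acts_length[of e q q']
    by (intro exI[of _ "p @ q' @ m"] exI[of _ g] exI[of _ g'] exI[of _ t]) auto
  ultimately show ?l by simp
qed

lemma run_exchange_below:
  assumes "pos e \<le> pos f"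
  shows "run [shift (strands_below e) f, e] s = Some r \<longleftrightarrow>
    (\<exists>p q q' m g g' t. s = p @ q @ m @ g @ t \<and> r = p @ q' @ m @ g' @ t \<and> length p = pos e \<and>
      length p + length m = pos f \<and> acts e q q' \<and> acts f g g')" (is "?l = ?r")
proof
  assume ?l
  then obtain s1 where "apply_event (shift (strands_below e) f) s = Some s1" "apply_event e s1 = Some r"
    by (auto split: option.splits)
  then obtain p q q' t1 p2 g g' t where *: "s1 = p @ q @ t1" "r = p @ q' @ t1" "length p = pos e"
      "acts e q q'"
    "s = p2 @ g @ t" "s1 = p2 @ g' @ t" "length p2 = pos f + strands_below e" "acts f g g'"
    unfolding apply_event_acts acts_shift pos_shift by blast
  have "(p @ q) @ t1 = p2 @ g' @ t" using *(1,6) by simp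
  moreover have len: "length (p @ q) \<le> length p2" using *(3,7) acts_length[OF *(4)] assms by simp
  ultimately obtain m where m: "p2 = (p @ q) @ m" "t1 = m @ g' @ t" using append_eq_append_le by blast
  from m(1) have "length p + length m = pos f" using *(7) acts_length[OF *(4)] by simp
  with m show ?r using *(2,5,3,4,8)
    by (intro exI conjI) (assumption | simp only: append_assoc)+
next
  assume ?r
  then obtain p q q' m g g' t where *: "s = p @ q @ m @ g @ t" "r = p @ q' @ m @ g' @ t" "length p =
      pos e"
    "length p + length m = pos f" "acts e q q'" "acts f g g'" by blast
  have "apply_event e (p @ q @ m @ g' @ t) = Some r" using * by (auto simp: apply_event_acts)
  moreover have "apply_event (shift (strands_below e) f) s = Some (p @ q @ m @ g' @ t)"
    unfolding apply_event_acts using * acts_length[of e q q']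
    by (intro exI[of _ "p @ q @ m"] exI[of _ g] exI[of _ g'] exI[of _ t]) auto
  ultimately show ?l by simp
qed

lemma run_exchange:
  assumes "pos e \<le> pos f"
  shows "run [e, shift (strands_above e) f] s = run [shift (strands_below e) f, e] s"
proof -
  have "run [e, shift (strands_above e) f] s = Some r \<longleftrightarrow>
      run [shift (strands_below e) f, e] s = Some r" for r
    unfolding run_exchange_above[OF assms] run_exchange_below[OF assms] ..
  then show ?thesis by (metis not_Some_eq)
qed

lemma shape_pair:
  "shape D = shape [e, f] \<longleftrightarrow> (\<exists>e' f'. D = [e', f'] \<and>
     relabel_event (\<lambda>_. 0) e' = relabel_event (\<lambda>_. 0) e \<and> relabel_event
         (\<lambda>_. 0) f' = relabel_event (\<lambda>_. 0) f)"
  by (auto simp: map_eq_Cons_conv)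

lemma shape_event_shift:
  "relabel_event (\<lambda>_. 0) f' = relabel_event (\<lambda>_. 0) (shift n f) \<longleftrightarrow>
     (\<exists>f''. f' = shift n f'' \<and> relabel_event (\<lambda>_. 0) f'' = relabel_event (\<lambda>_. 0) f)"
  by (cases f; cases f') (auto intro: exI[of _ "event.Min _ _ _"])

lemma shape_event_invariants:
  "relabel_event (\<lambda>_. 0) e' = relabel_event (\<lambda>_. 0) e \<Longrightarrow>
    pos e' = pos e \<and> strands_above e' = strands_above e \<and> strands_below e' = strands_below e"
  by (cases e; cases e') auto

text \<open>
  The second conclusion compares the labellings of the two fragments, the last two say that the
  labels inside \<open>y\<close> can be read off its boundary.
\<close>

definition replaceable :: "drawing \<Rightarrow> drawing \<Rightarrow> bool" where
  "replaceable x y \<longleftrightarrow> (\<forall>s s' y' r. run x s \<noteq> None \<and> run y s \<noteq> None \<and> map snd s' = map snd s \<and>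
     shape y' = shape y \<and> run y' s' = Some r \<longrightarrow>
       run x s = run y s \<and>
       (\<exists>x'. shape x' = shape x \<and> run x' s' = Some r) \<and>
       (\<forall>y''. shape y'' = shape y \<and> run y'' s' = Some r \<longrightarrow> y'' = y') \<and>
       labels y' \<subseteq> fst ` set s' \<union> fst ` set r)"

lemma replaceable_exchange:
  assumes "pos e \<le> pos f"
  shows "replaceable [e, shift (strands_above e) f] [shift (strands_below e) f, e]"
    and "replaceable [shift (strands_below e) f, e] [e, shift (strands_above e) f]"
proof -
  let ?sh = "relabel_event (\<lambda>_. 0)"
  \<comment> \<open>The flag \<open>\<beta>\<close> selects the order of the two events, so that one
    argument serves both directions.\<close>
  define pair where "pair \<beta> e' f' =
    (if \<beta> then [e', shift (strands_above e) f'] else [shift (strands_below e) f', e'])" for \<beta> e' f'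
  have main: "replaceable (pair \<beta> e f) (pair (\<not> \<beta>) e f)" for \<beta>
    unfolding replaceable_def
  proof (intro allI impI)
    fix s s' y' r
    let ?x = "pair \<beta> e f" let ?y = "pair (\<not> \<beta>) e f"
    assume asm: "run ?x s \<noteq> None \<and> run ?y s \<noteq> None \<and> map snd s' = map snd s \<and>
     shape y' = shape ?y \<and> run y' s' = Some r"
    have shape_pair_eq: "shape z = shape (pair \<gamma> e f) \<longleftrightarrow>
        (\<exists>e' f'. z = pair \<gamma> e' f' \<and> ?sh e' = ?sh e \<and> ?sh f' = ?sh f)" for \<gamma> z
      unfolding pair_def by (cases \<gamma>; simp only: if_True if_False shape_pair
          shape_event_shift; blast)
    have run_pair: "run (pair \<gamma> e' f') s = Some r \<longleftrightarrow>
      (\<exists>p q q' m g g' t. s = p @ q @ m @ g @ t \<and> r = p @ q' @ m @ g' @ t \<and> length p = pos e \<and>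
      length p + length m = pos f \<and> acts e' q q' \<and> acts f' g g')"
      if "?sh e' = ?sh e" "?sh f' = ?sh f" for e' f' \<gamma> s r
      using run_exchange_above[of e' f' s r] run_exchange_below[of e' f' s r] assms
        shape_event_invariants[OF that(1)] shape_event_invariants[OF that(2)]
      unfolding pair_def by simp
    have "run ?x s = run ?y s"
      using run_exchange[OF assms] by (auto simp: pair_def)
    moreover obtain e' f' where y': "y' = pair (\<not> \<beta>) e' f'" "?sh e' = ?sh e" "?sh f' = ?sh f"
      using asm shape_pair_eq[of y' "\<not> \<beta>"] by blast
    have ry: "run (pair (\<not> \<beta>) e' f') s' = Some r" using asm y'(1) by simp
    note ex = ry[unfolded run_pair[OF y'(2,3)]]
    from ex obtain p q q' m g g' t where dec: "s' = p @ q @ m @ g @ t" "r = p @ q' @ m @ g' @ t"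
        "length p = pos e"
      "length p + length m = pos f" "acts e' q q'" "acts f' g g'"
      by blast
    have "run (pair \<beta> e' f') s' = Some r" unfolding run_pair[OF y'(2,3)] by (rule ex)
    moreover have "shape (pair \<beta> e' f') = shape ?x" using shape_pair_eq[of _ \<beta>] y'(2,3) by blast
    moreover have "y'' = y'" if y'': "shape y'' = shape ?y \<and> run y'' s' = Some r" for y''
    proof -
      obtain e2 f2 where y2: "y'' = pair (\<not> \<beta>) e2 f2" "?sh e2 = ?sh e" "?sh f2 = ?sh f"
        using y'' shape_pair_eq[of y'' "\<not> \<beta>"] by blast
      have ry: "run (pair (\<not> \<beta>) e2 f2) s' = Some r" using y'' y2(1) by simp
      obtain p2 q2 q2' m2 g2 g2' t2 where dec2: "s' = p2 @ q2 @ m2 @ g2 @ t2" "r = p2 @ q2' @ m2 @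
          g2' @ t2"
        "length p2 = pos e" "length p2 + length m2 = pos f" "acts e2 q2 q2'" "acts f2 g2 g2'"
        using ry[unfolded run_pair[OF y2(2,3)]] by blast
      \<comment> \<open>The lengths of the blocks depend only on the shapes, so two decompositions
        of the same boundary coincide and determine both events.\<close>
      have len: "length p2 = length p" "length q2 = length q" "length q2' = length q'" "length m2 =
          length m"
        "length g2 = length g" "length g2' = length g'"
        using dec dec2 acts_length[OF dec(5)] acts_length[OF dec(6)] acts_length[OF dec2(5)]
            acts_length[OF dec2(6)]
          shape_event_invariants[OF y'(2)] shape_event_invariants[OF y2(2)]
          shape_event_invariants[OF y'(3)] shape_event_invariants[OF y2(3)] by auto
      have "p2 @ q2 @ m2 @ g2 @ t2 = p @ q @ m @ g @ t" "p2 @ q2' @ m2 @ g2' @ t2 = p @ q' @ m @ g' @ t"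
        using dec(1,2) dec2(1,2) by metis+
      then have "q2 = q" "g2 = g" "q2' = q'" "g2' = g'" using len by auto
      then have "e2 = e'" "f2 = f'"
        using acts_shape_unique dec(5,6) dec2(5,6) y'(2,3) y2(2,3) by metis+
      then show ?thesis using y' y2 by simp
    qed
    moreover have "labels y' \<subseteq> fst ` set s' \<union> fst ` set r"
    proof -
      have "labels y' = labels [e'] \<union> labels [f']"
        unfolding y'(1) pair_def by (cases e'; cases f') auto
      then show ?thesis using acts_labels[OF dec(5)] acts_labels[OF dec(6)] dec(2) by auto
    qed
    ultimately show "run ?x s = run ?y s \<and>
       (\<exists>x'. shape x' = shape ?x \<and> run x' s' = Some r) \<and>
       (\<forall>y''. shape y'' = shape ?y \<and> run y'' s' = Some r \<longrightarrow> y'' = y') \<and>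
       labels y' \<subseteq> fst ` set s' \<union> fst ` set r" by blast
  qed
  show "replaceable [e, shift (strands_above e) f] [shift (strands_below e) f, e]"
    using main[of True] by (simp add: pair_def)
  show "replaceable [shift (strands_below e) f, e] [e, shift (strands_above e) f]"
    using main[of False] by (simp add: pair_def)
qed

section \<open>Translation of fragments to the right\<close>

lemma apply_event_shift:
  "length p = n \<Longrightarrow> apply_event (shift n e) (p @ s) = map_option ((@) p) (apply_event e s)"
  by (cases e) (auto simp: nth_append)

lemma run_shift:
  "length p = n \<Longrightarrow> run (map (shift n) D) (p @ s) = map_option ((@) p) (run D s)"
  by (induction D arbitrary: s) (auto simp: apply_event_shift split: option.splits)

lemma run_shift_length: "D \<noteq> [] \<Longrightarrow> run (map (shift n) D) s \<noteq> None \<Longrightarrow> n \<le> length s"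
  by (cases D; cases "hd D") (auto split: if_splits)

lemma shape_shift:
  "shape D' = shape (map (shift n) D) \<longleftrightarrow> (\<exists>D''. D' = map (shift n) D'' \<and> shape D'' = shape D)"
proof (induction D arbitrary: D')
  case (Cons e D)
  have "shape D' = shape (map (shift n) (e # D)) \<longleftrightarrow> (\<exists>e' E. D' = shift n e' # map (shift n) E \<and>
        relabel_event (\<lambda>_. 0) e' = relabel_event (\<lambda>_. 0) e \<and> shape E = shape D)"
    unfolding list.map(2) map_eq_Cons_conv shape_event_shift Cons.IH by blast
  also have "\<dots> \<longleftrightarrow> (\<exists>D''. D' = map (shift n) D'' \<and> shape D'' = shape (e # D))"
    (is "?a \<longleftrightarrow> ?b")
  proof
    assume ?a
    then obtain e' E where "D' = shift n e' # map (shift n) E"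
      "relabel_event (\<lambda>_. 0) e' = relabel_event (\<lambda>_. 0) e" "shape E = shape D" by blast
    then show ?b by (intro exI[of _ "e' # E"]) simp
  next
    assume ?b
    then obtain z zs where "D' = shift n z # map (shift n) zs"
      "relabel_event (\<lambda>_. 0) z = relabel_event (\<lambda>_. 0) e" "shape zs = shape D"
      unfolding list.map(2) map_eq_Cons_conv by auto
    then show ?a by (intro exI[of _ z] exI[of _ zs]) simp
  qed
  finally show ?case .
qed auto

lemma labels_shift [simp]: "labels (map (shift n) D) = labels D"
proof (induction D)
  case (Cons e D)
  then show ?case by (cases e) auto
qed simp

text \<open>Reduces the remaining moves to position 0, where they act on concrete short
  lists.\<close>

lemma replaceable_shift:
  assumes "replaceable x y"
  shows "replaceable (map (shift n) x) (map (shift n) y)"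
  unfolding replaceable_def
proof (intro allI impI)
  fix s s' y' r
  assume asm: "run (map (shift n) x) s \<noteq> None \<and> run (map (shift n) y) s \<noteq> None
      \<and> map snd s' = map snd s \<and>
     shape y' = shape (map (shift n) y) \<and> run y' s' = Some r"
  show "run (map (shift n) x) s = run (map (shift n) y) s \<and>
       (\<exists>x'. shape x' = shape (map (shift n) x) \<and> run x' s' = Some r) \<and>
       (\<forall>y''. shape y'' = shape (map (shift n) y) \<and> run y'' s' = Some r \<longrightarrow> y'' = y') \<and>
       labels y' \<subseteq> fst ` set s' \<union> fst ` set r"
  \<comment> \<open>If both fragments are empty, there may be fewer than \<open>n\<close> strands,
    so the split below is impossible; but then the claim is trivial.\<close>
  proof (cases "x = [] \<and> y = []")
    case False
    then have n: "n \<le> length s" using run_shift_length asm by blast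
    moreover have "length s' = length s" using asm map_eq_imp_length_eq by blast
    ultimately obtain p t p' t' where st: "s = p @ t" "length p = n" "s' = p' @ t'" "length p' = n"
      by (metis append_take_drop_id length_take min.absorb2)
    obtain y0 where y0: "y' = map (shift n) y0" "shape y0 = shape y" using asm by (auto simp only:
        shape_shift)
    have snd: "map snd t' = map snd t" using asm st by simp
    obtain r0 where r0: "run y0 t' = Some r0" "r = p' @ r0"
      using asm run_shift[OF st(4), of y0 t'] y0 st by auto
    have "run x t \<noteq> None \<and> run y t \<noteq> None"
      using asm run_shift[OF st(2)] st by auto
    note R = assms[unfolded replaceable_def, rule_format, of t t' y0 r0, OF conjI[OF conjunct1[OF this]
          conjI[OF conjunct2[OF this] conjI[OF snd conjI[OF y0(2) r0(1)]]]]]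
    from R obtain x0 where x0: "shape x0 = shape x" "run x0 t' = Some r0" by blast
    have "run (map (shift n) x) s = run (map (shift n) y) s"
      using R run_shift[OF st(2)] st by simp
    moreover have "shape (map (shift n) x0) = shape (map (shift n) x)"
      using x0 shape_shift by blast
    moreover have "run (map (shift n) x0) s' = Some r"
      using x0 r0 run_shift[OF st(4)] st by simp
    moreover have "y'' = y'" if y'': "shape y'' = shape (map (shift n) y)" "run y'' s' = Some r" for y''
    proof -
      obtain y2 where y2: "y'' = map (shift n) y2" "shape y2 = shape y" using y'' by (auto simp only:
          shape_shift)
      then have "run y2 t' = Some r0" using y''(2) run_shift[OF st(4), of y2 t'] st r0 by auto
      then show ?thesis using R y2 y0 by blast
    qed
    moreover have "labels y' \<subseteq> fst ` set s' \<union> fst ` set r"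
    proof -
      have "labels y0 \<subseteq> fst ` set t' \<union> fst ` set r0" using R by blast
      then show ?thesis unfolding y0(1) labels_shift st(3) r0(2) by auto
    qed
    ultimately show ?thesis by blast
  qed (use asm in auto)
qed

section \<open>Evaluation of the remaining moves at position 0\<close>

lemma shape_simps:
  "shape D = [] \<longleftrightarrow> D = []"
  "shape D = Min i m d # E \<longleftrightarrow> m = 0 \<and> (\<exists>l D'. D = Min i l d # D' \<and> shape D' = E)"
  "shape D = Max i # E \<longleftrightarrow> (\<exists>D'. D = Max i # D' \<and> shape D' = E)"
  "shape D = Cross i t # E \<longleftrightarrow> (\<exists>D'. D = Cross i t # D' \<and> shape D' = E)"
  by (auto simp: map_eq_Cons_conv)

text \<open>At position 0 no move reads strands beyond the third at the bottom, so this case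
  distinction lets \<open>run\<close> be evaluated completely.\<close>

lemma strands3_cases:
  obtains "s = []" | a where "s = [a]" | a b where "s = [a, b]" | a b c t where "s = a # b # c # t"
proof (cases s)
  case (Cons a u)
  note s = this
  show ?thesis
  proof (cases u)
    case (Cons b v)
    with s that(3,4) show ?thesis by (cases v) auto
  qed (use s that(2) in auto)
qed (use that(1) in auto)

lemma replaceableI:
  assumes "\<And>s s' y' r. run x s \<noteq> None \<Longrightarrow> run y s \<noteq> None \<Longrightarrow> map snd s' = map snd s \<Longrightarrow>
     shape y' = shape y \<Longrightarrow> run y' s' = Some r \<Longrightarrow>
       run x s = run y s \<and>
       (\<exists>x'. shape x' = shape x \<and> run x' s' = Some r) \<and>
       (\<forall>y''. shape y'' = shape y \<and> run y'' s' = Some r \<longrightarrow> y'' = y') \<and>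
       labels y' \<subseteq> fst ` set s' \<union> fst ` set r"
  shows "replaceable x y"
  using assms unfolding replaceable_def by blast

lemma replaceable_zigzag_right:
  "replaceable [] [Min 1 l d, Max 0]"
  "replaceable [Min 1 l d, Max 0] []"
  by (rule replaceableI; case_tac s rule: strands3_cases; case_tac s' rule: strands3_cases;
      auto simp: shape_simps split: if_splits)+

lemma replaceable_zigzag_left:
  "replaceable [] [Min 0 l d, Max 1]"
  "replaceable [Min 0 l d, Max 1] []"
  by (rule replaceableI; case_tac s rule: strands3_cases; case_tac s' rule: strands3_cases;
      auto simp: shape_simps split: if_splits)+

lemma replaceable_kink_right:
  "replaceable [] [Min 1 l d, Cross 0 t, Max 1]"
  "replaceable [Min 1 l d, Cross 0 t, Max 1] []"
  by (rule replaceableI; case_tac s rule: strands3_cases; case_tac s' rule: strands3_cases;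
      auto simp: shape_simps split: if_splits)+

lemma replaceable_kink_left:
  "replaceable [] [Min 0 l d, Cross 1 t, Max 0]"
  "replaceable [Min 0 l d, Cross 1 t, Max 0] []"
  by (rule replaceableI; case_tac s rule: strands3_cases; case_tac s' rule: strands3_cases;
      auto simp: shape_simps split: if_splits)+

text \<open>The types \<open>t\<close> and \<open>t'\<close> are independent here because a crossing
  permutes strands in the same way whatever its type.\<close>

lemma replaceable_rotate_max:
  "replaceable [Cross 1 t, Max 0] [Cross 0 t', Max 1]"
  "replaceable [Cross 0 t', Max 1] [Cross 1 t, Max 0]"
  by (rule replaceableI; case_tac s rule: strands3_cases; case_tac s' rule: strands3_cases;
      auto simp: shape_simps split: if_splits)+

lemma replaceable_rotate_min:
  "replaceable [Min 0 l d, Cross 1 t] [Min 1 l d, Cross 0 t']"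
  "replaceable [Min 1 l d, Cross 0 t'] [Min 0 l d, Cross 1 t]"
  by (rule replaceableI; case_tac s rule: strands3_cases; case_tac s' rule: strands3_cases;
      auto simp: shape_simps split: if_splits)+

lemma replaceable_bigon:
  "replaceable [] [Cross 0 t, Cross 0 t']"
  "replaceable [Cross 0 t, Cross 0 t'] []"
  by (rule replaceableI; case_tac s rule: strands3_cases; case_tac s' rule: strands3_cases;
      auto simp: shape_simps split: if_splits)+

lemma replaceable_triangle:
  "replaceable [Cross 0 t1, Cross 1 t2, Cross 0 t3] [Cross 1 t3, Cross 0 t2, Cross 1 t1]"
  "replaceable [Cross 1 t3, Cross 0 t2, Cross 1 t1] [Cross 0 t1, Cross 1 t2, Cross 0 t3]"
  by (rule replaceableI; case_tac s rule: strands3_cases; case_tac s' rule: strands3_cases;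
      auto simp: shape_simps split: if_splits)+

lemma local_move_replaceable:
  assumes "local_move m x y K"
  shows "replaceable x y \<and> replaceable y x"
  using assms
proof cases
  case (exchange e f)
  then show ?thesis using replaceable_exchange by simp
next
  case (zigzag_right i l d)
  then show ?thesis
    using replaceable_shift[OF replaceable_zigzag_right(1), of i l d] replaceable_shift[OF
        replaceable_zigzag_right(2), of i l d] by simp
next
  case (zigzag_left i l d)
  then show ?thesis
    using replaceable_shift[OF replaceable_zigzag_left(1), of i l d] replaceable_shift[OF
        replaceable_zigzag_left(2), of i l d] by simp
next
  case (rotate_max i t)
  then show ?thesis
    using replaceable_shift[OF replaceable_rotate_max(1), of i t "flip t"] replaceable_shift[OF
        replaceable_rotate_max(2), of i "flip t" t] by simp
next
  case (rotate_min i l d t)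
  then show ?thesis
    using replaceable_shift[OF replaceable_rotate_min(1), of i l d t "flip t"] replaceable_shift[OF
        replaceable_rotate_min(2), of i l d "flip t" t] by simp
next
  case (kink_right t i l d)
  then show ?thesis
    using replaceable_shift[OF replaceable_kink_right(1), of i l d t] replaceable_shift[OF
        replaceable_kink_right(2), of i l d t] by simp
next
  case (kink_left t i l d)
  then show ?thesis
    using replaceable_shift[OF replaceable_kink_left(1), of i l d t] replaceable_shift[OF
        replaceable_kink_left(2), of i l d t] by simp
next
  case (bigon t i)
  then show ?thesis
    using replaceable_shift[OF replaceable_bigon(1), of i t "flip t"] replaceable_shift[OF
        replaceable_bigon(2), of i t "flip t"] by simp
next
  case (triangle t1 t2 t3 i)
  then show ?thesis
    using replaceable_shift[OF replaceable_triangle(1), of i t1 t2 t3] replaceable_shift[OF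
        replaceable_triangle(2), of i t3 t2 t1] by simp
qed

section \<open>Replacing a fragment inside a diagram\<close>

lemma shape_append:
  "shape D = shape (u @ x @ z) \<longleftrightarrow>
    (\<exists>u' x' z'. D = u' @ x' @ z' \<and> shape u' = shape u \<and> shape x' = shape x \<and> shape z' = shape z)"
proof
  assume "shape D = shape (u @ x @ z)"
  then obtain u' w where u': "D = u' @ w" "shape u' = shape u" "shape w = shape x @ shape z"
    using map_eq_append_conv[of "relabel_event (\<lambda>_. 0)" D "shape u" "shape x @ shape z"] by auto
  obtain x' z' where "w = x' @ z'" "shape x' = shape x" "shape z' = shape z"
    using map_eq_append_conv[of "relabel_event (\<lambda>_. 0)" w "shape x" "shape z"] u'(3) by auto
  with u' show "\<exists>u' x' z'. D = u' @ x' @ z' \<and> shape u' = shape u \<and> shape x' = shape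
      x \<and> shape z' = shape z"
    by blast
qed auto

lemma replaceableD:
  assumes "replaceable y x" "run x s = Some r" "run y s \<noteq> None"
  shows "run y s = Some r \<and> labels x \<subseteq> fst ` set s \<union> fst ` set r"
proof -
  have "run x s \<noteq> None" using assms(2) by simp
  from assms(1)[unfolded replaceable_def, rule_format, of s s x r,
      OF conjI[OF assms(3) conjI[OF this conjI[OF refl conjI[OF refl assms(2)]]]]]
  show ?thesis using assms(2) by simp
qed

text \<open>A competing labelling of the new drawing is carried back to the old fragment, where it
  is a relabelling by some \<open>\<phi>\<close>. Its boundary strands are then relabelled by
  \<open>\<phi>\<close> as well, and the boundary determines the labels inside
  \<open>y\<close>.\<close>

lemma diagram_replace:
  assumes xy: "replaceable x y" and yx: "replaceable y x"
    and D: "diagram (u @ x @ z)" and s: "run u [] = Some s" and y: "run y s \<noteq> None"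
  shows "diagram (u @ y @ z)"
proof -
  from D have ok: "run (u @ x @ z) [] = Some []" and fin: "finest_labels (u @ x @ z)"
    and lab: "\<exists>n. labels (u @ x @ z) = {1..n}" by (auto simp: diagram_iff)
  from ok s obtain r where r: "run x s = Some r" "run z r = Some []" by (auto simp: run_append_Some)
  have x: "run x s \<noteq> None" using r by simp
  from replaceableD[OF yx r(1) y] have yr: "run y s = Some r" and lab_x: "labels x \<subseteq> fst `
      set s \<union> fst ` set r"
    by auto
  from replaceableD[OF xy yr x] have lab_y: "labels y \<subseteq> fst ` set s \<union> fst ` set r" ..
  have "run (u @ y @ z) [] = Some []" using s yr r by (simp add: run_append)
  moreover have "labels (u @ y @ z) = labels (u @ x @ z)"
  proof -
    \<comment> \<open>Labels in one fragment occur on the boundary; those at the bottom come from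
      \<open>u\<close>, those at the top from the bottom or from the other fragment.\<close>
    have sub: "A \<subseteq> U \<union> B" if "A \<subseteq> S \<union> R" "S \<subseteq> {} \<union> U" "R \<subseteq> S \<union> B" for A B R S U :: "nat set"
      using that by blast
    have "fst ` set s \<subseteq> {} \<union> labels u" using run_labels[OF s] by simp
    note sub[OF lab_x this run_labels[OF yr]] sub[OF lab_y this run_labels[OF r(1)]]
    then show ?thesis by auto
  qed
  moreover have "finest_labels (u @ y @ z)"
    unfolding finest_labels_def
  proof (intro allI impI, elim conjE)
    fix D' assume sh: "shape D' = shape (u @ y @ z)" and run: "run D' [] = Some []"
    obtain u' y' z' where D': "D' = u' @ y' @ z'" "shape u' = shape u" "shape y' = shape y" "shape z'
        = shape z"
      using sh unfolding shape_append by blast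
    obtain s' r' where run': "run u' [] = Some s'" "run y' s' = Some r'" "run z' r' = Some []"
      using run D' by (auto simp: run_append_Some)
    have dir: "map snd s' = map snd s" using run_shape_directions[OF s run'(1) D'(2)] by simp
    note R = xy[unfolded replaceable_def, rule_format, of s s' y' r', OF conjI[OF x conjI[OF y
        conjI[OF dir conjI[OF D'(3) run'(2)]]]]]
    \<comment> \<open>The competitor for the old diagram with the same boundary strands
      \<open>s'\<close> and \<open>r'\<close>.\<close>
    from R obtain x' where x': "shape x' = shape x" "run x' s' = Some r'" by blast
    have "run (u' @ x' @ z') [] = Some []" using run' x' by (simp add: run_append)
    moreover have "shape (u' @ x' @ z') = shape (u @ x @ z)" using D' x' by simp
    ultimately obtain \<phi> where \<phi>: "u' @ x' @ z' = map (relabel_event \<phi>) (u @ x @ z)"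
      using fin unfolding finest_labels_def by blast
    have len: "length u' = length u" "length x' = length x" "length z' = length z"
      using D' x' map_eq_imp_length_eq by blast+
    have eqs: "u' = map (relabel_event \<phi>) u" "x' = map (relabel_event \<phi>) x" "z' = map
        (relabel_event \<phi>) z"
      using \<phi> len by auto
    have "s' = relabel_strands \<phi> s" using run_relabel[OF s, of \<phi>] run'(1) eqs by simp
    moreover from this have "r' = relabel_strands \<phi> r" using run_relabel[OF r(1), of \<phi>]
        x'(2) eqs by simp
    ultimately have "run (map (relabel_event \<phi>) y) s' = Some r'" using run_relabel[OF yr, of
        \<phi>] by simp
    then have "map (relabel_event \<phi>) y = y'" using R shape_relabel by blast
    then show "\<exists>\<phi>. D' = map (relabel_event \<phi>) (u @ y @ z)" using eqs D' by auto
  qed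
  ultimately show ?thesis using lab by (simp add: diagram_iff)
qed

subsection \<open>Following a crossing\<close>

text \<open>Unlike \<open>uninvolved_corr\<close> this keeps the events matched inside the fragment
  for every kind of move. Thus it follows each crossing that survives the move.\<close>

definition corr :: "drawing \<Rightarrow> drawing \<Rightarrow> drawing \<Rightarrow> (nat \<times> nat) set \<Rightarrow> (nat \<times> nat) set" where
  "corr u x y K = outer_corr u x y \<union> inner_corr u K"

lemma corr_iff:
  "(c, c') \<in> corr u x y K \<longleftrightarrow> c = c' \<and> c < length u \<or>
    (\<exists>k. c = length u + length x + k \<and> c' = length u + length y + k) \<or>
    (\<exists>a b. (a, b) \<in> K \<and> c = length u + a \<and> c' = length u + b)"
  by (auto simp: corr_def outer_corr_def inner_corr_def)

lemma corr_converse: "(c, c') \<in> corr u x y K \<Longrightarrow> (c', c) \<in> corr u y x (K\<inverse>)"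
  by (auto simp: corr_iff)

lemma move_sym: "move m u z x y K \<Longrightarrow> move m u z y x (K\<inverse>)"
  by (auto simp: move_def)

text \<open>A step along which the values of weight functions stay fixed. In a crossing change the
  followed crossing must differ from the changed one, since locality says nothing about the
  latter.\<close>

inductive track :: "drawing \<times> nat \<Rightarrow> drawing \<times> nat \<Rightarrow> bool" where
  move: "move m u z x y K \<Longrightarrow> (c, c') \<in> corr u x y K \<Longrightarrow> track (u @ x @ z, c) (u @ y @ z, c')"
| change: "k \<in> crossings D \<Longrightarrow> k \<noteq> c \<Longrightarrow> track (D, c) (crossing_change D k, c)"

text \<open>The same inside a piece of a drawing above the strands \<open>s\<close>. A piece is not
  a closed diagram, so it is only required to run; \<open>local_track_lift\<close> recovers
  \<open>diagram\<close> for the whole.\<close>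

inductive local_track :: "strand list \<Rightarrow> drawing \<times> nat \<Rightarrow> drawing \<times> nat \<Rightarrow> bool" for s where
  local_trackI: "local_move m x y K \<or> local_move m y x (K\<inverse>) \<Longrightarrow>
    run (u @ x @ z) s \<noteq> None \<Longrightarrow> run (u @ y @ z) s \<noteq> None \<Longrightarrow> (c, c') \<in> corr u x y K \<Longrightarrow>
    local_track s (u @ x @ z, c) (u @ y @ z, c')"

lemma local_track_sym: "local_track s X Y \<Longrightarrow> local_track s Y X"
  by (elim local_track.cases) (auto intro: local_trackI[rotated 3, OF corr_converse])

abbreviation local_tracks :: "strand list \<Rightarrow> drawing \<times> nat \<Rightarrow> drawing \<times> nat \<Rightarrow> bool" where
  "local_tracks s \<equiv> (local_track s)\<^sup>*\<^sup>*"

lemma local_tracks_sym: "local_tracks s X Y \<Longrightarrow> local_tracks s Y X"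
  by (metis local_track_sym sympI sympD symp_rtranclp)

lemma local_track_lift:
  assumes "local_track s (x, c) (y, c')" "run U [] = Some s" "diagram (U @ x @ Z)"
  shows "diagram (U @ y @ Z) \<and> track (U @ x @ Z, length U + c) (U @ y @ Z, length U + c')"
  using assms(1)
proof cases
  case (local_trackI m x' y' K u z)
  obtain s1 where s1: "run u s = Some s1" using local_trackI(4) by (auto simp: run_append split:
      option.splits)
  have "run y' s1 \<noteq> None" using local_trackI(5) s1 by (auto simp: run_append split: option.splits)
  moreover have "replaceable x' y' \<and> replaceable y' x'" using local_trackI(3)
      local_move_replaceable by blast
  ultimately have D: "diagram ((U @ u) @ y' @ z @ Z)"
    using diagram_replace[of x' y' "U @ u" "z @ Z" s1] assms(2,3) s1 local_trackI(1) by (simp add: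
        run_append)
  have "move m (U @ u) (z @ Z) x' y' K"
    unfolding move_def using D assms(3) local_trackI(1,3) by simp
  moreover have "(length U + c, length U + c') \<in> corr (U @ u) x' y' K"
    using local_trackI(6) by (auto simp: corr_iff)
  ultimately show ?thesis using D local_trackI(1,2) track.move[of m "U @ u" "z @ Z" x' y' K] by simp
qed

lemma local_tracks_lift:
  assumes "local_tracks s X Y" "run U [] = Some s" "diagram (U @ fst X @ Z)"
  shows "diagram (U @ fst Y @ Z) \<and> track\<^sup>*\<^sup>* (U @ fst X @ Z, length U + snd X) (U @
      fst Y @ Z, length U + snd Y)"
  using assms(1)
proof (induction rule: rtranclp_induct)
  case (step Y Y')
  then show ?case
    using local_track_lift[of s "fst Y" "snd Y" "fst Y'" "snd Y'" U Z] assms(2)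
    by (auto intro: rtranclp.rtrancl_into_rtrancl)
qed (use assms(3) in auto)

section \<open>Translation, symmetry and composition of tracks\<close>

lemma shift_shift [simp]: "shift m (shift n e) = shift (n + m) e"
  by (cases e) auto

lemma local_move_shift: "local_move m x y K \<Longrightarrow> local_move m (map (shift n) x) (map (shift n) y) K"
proof (induction rule: local_move.induct)
  case (exchange e f)
  then show ?case using local_move.exchange[of "shift n e" "shift n f"] by (simp add: add.commute)
next
  case (zigzag_right i l d)
  then show ?case using local_move.zigzag_right[of "i + n" l d] by simp
next
  case (zigzag_left i l d)
  then show ?case using local_move.zigzag_left[of "i + n" l d] by simp
next
  case (rotate_max i t)
  then show ?case using local_move.rotate_max[of "i + n" t] by simp
next
  case (rotate_min i l d t)
  then show ?case using local_move.rotate_min[of "i + n" l d t] by simp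
next
  case (kink_right m t i l d)
  then show ?case using local_move.kink_right[of m t "i + n" l d] by simp
next
  case (kink_left m t i l d)
  then show ?case using local_move.kink_left[of m t "i + n" l d] by simp
next
  case (bigon m t i)
  then show ?case using local_move.bigon[of m t "i + n"] by simp
next
  case (triangle m t1 t2 t3 i)
  then show ?case using local_move.triangle[of m t1 t2 t3 "i + n"] by simp
qed

lemma local_track_shift:
  assumes "local_track s (x, c) (y, c')" "length p = n"
  shows "local_track (p @ s) (map (shift n) x, c) (map (shift n) y, c')"
  using assms(1)
proof cases
  case (local_trackI m x' y' K u z)
  have "run (map (shift n) (u @ x' @ z)) (p @ s) \<noteq> None" "run (map (shift n) (u @ y' @ z)) (p
      @ s) \<noteq> None"
    using local_trackI(4,5) unfolding run_shift[OF assms(2)] by auto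
  then show ?thesis
    using local_track.local_trackI[of m "map (shift n) x'" "map (shift n) y'" K "map (shift n) u"
        "map (shift n) z" "p @ s" c c']
      local_trackI local_move_shift by (auto simp: corr_iff)
qed

lemma local_tracks_shift:
  assumes "local_tracks s X Y" "length p = n"
  shows "local_tracks (p @ s) (map (shift n) (fst X), snd X) (map (shift n) (fst Y), snd Y)"
  using assms(1)
proof (induction rule: rtranclp_induct)
  case (step Y Y')
  then show ?case
    using local_track_shift[of s "fst Y" "snd Y" "fst Y'" "snd Y'" p n] assms(2)
    by (auto intro: rtranclp.rtrancl_into_rtrancl)
qed auto

lemma flip_flip [simp]: "flip (flip t) = t" "flip t = Virtual \<longleftrightarrow> t = Virtual"
  by (cases t; simp)+

lemma crossings_flip: "k \<in> crossings (D[j := flip_event (D ! j)]) \<longleftrightarrow> k \<in> crossings D"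
proof (cases "k = j \<and> k < length D")
  case True
  then show ?thesis by (cases "D ! k") (auto simp: crossings_def)
qed (auto simp: crossings_def nth_list_update)

lemma crossings_change [simp]: "crossings (crossing_change D k) = crossings D"
  using crossings_flip by (auto simp: crossing_change_def)

lemma flip_event_flip_event [simp]: "flip_event (flip_event e) = e"
  by (cases e) auto

lemma crossing_change_twice [simp]: "crossing_change (crossing_change D k) k = D"
  by (cases "k < length D") (simp_all add: crossing_change_def list_update_beyond)

lemma track_sym: "track X Y \<Longrightarrow> track Y X"
proof (induction rule: track.induct)
  case (move m u z x y K c c')
  then show ?case using track.move[OF move_sym corr_converse] by blast
next
  case (change k D c)
  then show ?case using track.change[of k "crossing_change D k" c] by simp
qed

lemma tracks_sym: "track\<^sup>*\<^sup>* X Y \<Longrightarrow> track\<^sup>*\<^sup>* Y X"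
  by (metis track_sym sympI sympD symp_rtranclp)

text \<open>With \<open>X\<close> and \<open>Y\<close> given by equations, concrete drawings can be
  matched by simplification once \<open>u\<close> and \<open>z\<close> are supplied.\<close>

lemma forward:
  assumes "local_move m x y K" "run (u @ x @ z) s \<noteq> None" "run (u @ y @ z) s \<noteq> None"
      "(c, c') \<in> corr u x y K"
    "X = u @ x @ z" "Y = u @ y @ z"
  shows "local_tracks s (X, c) (Y, c')"
  using assms local_trackI by blast

lemma backward:
  assumes "local_move m y x K" "run (u @ x @ z) s \<noteq> None" "run (u @ y @ z) s \<noteq> None"
      "(c', c) \<in> corr u y x K"
    "X = u @ x @ z" "Y = u @ y @ z"
  shows "local_tracks s (X, c) (Y, c')"
  using forward[OF assms(1,3,2,4,6,5)] by (rule local_tracks_sym)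

text \<open>Two of the three crossings lie on the strand that passes by and have its type
  \<open>v\<close>. If \<open>v\<close> is classical, this strand is over both others or under both,
  so the triangle is not cyclic.\<close>

lemma triangle_classical:
  assumes "t \<noteq> Virtual"
  shows "Defs.triangle (if v = Virtual then SV else RIII) t v v"
    and "Defs.triangle (if v = Virtual then SV else RIII) v v t"
  using assms by (auto intro: triangle.intros)

text \<open>
  Sliding a kink through a crossing: the other strand first makes a bigon with the loop of the kink,
  then passes the crossing of the kink, and finally leaves the loop through another bigon.
\<close>

lemma slide_right_kink_right:
  assumes "t \<noteq> Virtual"
  shows "local_tracks ((l, d) # b # s)
    ([Min 1 l d, Cross 0 t, Max 1, Cross 0 v], 1)
    ([Cross 0 v, Min 2 l d, Cross 1 t, Max 2], 2)"
proof -
  let ?T = "local_tracks ((l, d) # b # s)"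
  have "?T ([Min 1 l d, Cross 0 t, Max 1, Cross 0 v], 1)
      ([Min 1 l d, Cross 0 t, Cross 2 v, Cross 2 (flip v), Max 1, Cross 0 v], 1)"
    by (rule forward[OF local_move.bigon[OF refl, of "v" "2"],
        of "[Min 1 l d, Cross 0 t]" "[Max 1, Cross 0 v]"])
      (auto simp: corr_iff numeral_eq_Suc)
  also have "?T \<dots> ([Min 1 l d, Cross 0 t, Cross 2 v, Cross 1 v, Max 2, Cross 0 v], 1)"
    by (rule forward[OF local_move.rotate_max[of "1" "flip v"],
        of "[Min 1 l d, Cross 0 t, Cross 2 v]" "[Cross 0 v]"])
      (auto simp: corr_iff numeral_eq_Suc)
  also have "?T \<dots> ([Min 1 l d, Cross 0 t, Cross 2 v, Cross 1 v, Cross 0 v, Max 2], 1)"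
    by (rule backward[OF local_move.exchange[of "Cross 0 v" "Max 0"],
        of "[Min 1 l d, Cross 0 t, Cross 2 v, Cross 1 v]" "[]"])
      (auto simp: corr_iff numeral_eq_Suc)
  also have "?T \<dots> ([Min 1 l d, Cross 2 v, Cross 0 t, Cross 1 v, Cross 0 v, Max 2], 2)"
    by (rule forward[OF local_move.exchange[of "Cross 0 t" "Cross 0 v"],
        of "[Min 1 l d]" "[Cross 1 v, Cross 0 v, Max 2]"])
      (auto simp: corr_iff numeral_eq_Suc)
  \<comment> \<open>The only step in which \<open>t\<close> takes part in a move that is not an
    isotopy.\<close>
  also have "?T \<dots> ([Min 1 l d, Cross 2 v, Cross 1 v, Cross 0 v, Cross 1 t, Max 2], 4)"
    by (rule forward[OF local_move.triangle[OF triangle_classical(1)[OF assms, of v], of "0"],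
        of "[Min 1 l d, Cross 2 v]" "[Max 2]"])
      (auto simp: corr_iff numeral_eq_Suc)
  also have "?T \<dots> ([Min 2 l d, Cross 1 (flip v), Cross 1 v, Cross 0 v, Cross 1 t, Max 2], 4)"
    by (rule forward[OF local_move.rotate_min[of "1" l "d" "v"],
        of "[]" "[Cross 1 v, Cross 0 v, Cross 1 t, Max 2]"])
      (auto simp: corr_iff numeral_eq_Suc)
  also have "?T \<dots> ([Min 2 l d, Cross 0 v, Cross 1 t, Max 2], 2)"
    by (rule backward[OF local_move.bigon[OF refl, of "flip v" "1"],
        of "[Min 2 l d]" "[Cross 0 v, Cross 1 t, Max 2]"])
      (auto simp: corr_iff numeral_eq_Suc)
  also have "?T \<dots> ([Cross 0 v, Min 2 l d, Cross 1 t, Max 2], 2)"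
    by (rule backward[OF local_move.exchange[of "Cross 0 v" "Min 0 l d"],
        of "[]" "[Cross 1 t, Max 2]"])
      (auto simp: corr_iff numeral_eq_Suc)
  finally show ?thesis .
qed

text \<open>In the names of the four slides, the first side is that of the kink and the second is
  the direction in which its strand passes the crossing. Here the loop lies away from the incoming
  strand, so the crossing \<open>v\<close> can first be lowered below the maximum of the
  loop.\<close>

lemma slide_left_kink_right:
  assumes "t \<noteq> Virtual"
  shows "local_tracks ((l, d) # b # s)
    ([Min 0 l (\<not> d), Cross 1 t, Max 0, Cross 0 v], 1)
    ([Cross 0 v, Min 1 l (\<not> d), Cross 2 t, Max 1], 2)"
proof -
  let ?T = "local_tracks ((l, d) # b # s)"
  have "?T ([Min 0 l (\<not> d), Cross 1 t, Max 0, Cross 0 v], 1)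
      ([Min 0 l (\<not> d), Cross 1 t, Cross 2 v, Max 0], 1)"
    by (rule forward[OF local_move.exchange[of "Max 0" "Cross 0 v"],
        of "[Min 0 l (\<not> d), Cross 1 t]" "[]"])
      (auto simp: corr_iff numeral_eq_Suc)
  also have "?T \<dots> ([Min 0 l (\<not> d), Cross 1 t, Cross 2 v, Cross 1 v, Cross 1 (flip v), Max 0], 1)"
    by (rule forward[OF local_move.bigon[OF refl, of "v" "1"],
        of "[Min 0 l (\<not> d), Cross 1 t, Cross 2 v]" "[Max 0]"])
      (auto simp: corr_iff numeral_eq_Suc)
  also have "?T \<dots> ([Min 0 l (\<not> d), Cross 1 t, Cross 2 v, Cross 1 v, Cross 0 v, Max 1], 1)"
    by (rule forward[OF local_move.rotate_max[of "0" "flip v"],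
        of "[Min 0 l (\<not> d), Cross 1 t, Cross 2 v, Cross 1 v]" "[]"])
      (auto simp: corr_iff numeral_eq_Suc)
  also have "?T \<dots> ([Min 0 l (\<not> d), Cross 2 v, Cross 1 v, Cross 2 t, Cross 0 v, Max 1], 3)"
    by (rule forward[OF local_move.triangle[OF triangle_classical(1)[OF assms, of v], of "1"],
        of "[Min 0 l (\<not> d)]" "[Cross 0 v, Max 1]"])
      (auto simp: corr_iff numeral_eq_Suc)
  also have "?T \<dots> ([Min 0 l (\<not> d), Cross 2 v, Cross 1 v, Cross 0 v, Cross 2 t, Max 1], 4)"
    by (rule backward[OF local_move.exchange[of "Cross 0 v" "Cross 0 t"],
        of "[Min 0 l (\<not> d), Cross 2 v, Cross 1 v]" "[Max 1]"])
      (auto simp: corr_iff numeral_eq_Suc)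
  also have "?T \<dots> ([Cross 0 v, Min 0 l (\<not> d), Cross 1 v, Cross 0 v, Cross 2 t, Max 1], 4)"
    by (rule forward[OF local_move.exchange[of "Min 0 l (\<not> d)" "Cross 0 v"],
        of "[]" "[Cross 1 v, Cross 0 v, Cross 2 t, Max 1]"])
      (auto simp: corr_iff numeral_eq_Suc)
  also have "?T \<dots> ([Cross 0 v, Min 1 l (\<not> d), Cross 0 (flip v), Cross 0 v, Cross 2 t, Max 1], 4)"
    by (rule forward[OF local_move.rotate_min[of "0" l "\<not> d" "v"],
        of "[Cross 0 v]" "[Cross 0 v, Cross 2 t, Max 1]"])
      (auto simp: corr_iff numeral_eq_Suc)
  also have "?T \<dots> ([Cross 0 v, Min 1 l (\<not> d), Cross 2 t, Max 1], 2)"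
    by (rule backward[OF local_move.bigon[OF refl, of "flip v" "0"],
        of "[Cross 0 v, Min 1 l (\<not> d)]" "[Cross 2 t, Max 1]"])
      (auto simp: corr_iff numeral_eq_Suc)
  finally show ?thesis .
qed

lemma slide_right_kink_left:
  assumes "t \<noteq> Virtual"
  shows "local_tracks (a # (l, d) # s)
    ([Min 2 l d, Cross 1 t, Max 2, Cross 0 v], 1)
    ([Cross 0 v, Min 1 l d, Cross 0 t, Max 1], 2)"
proof -
  let ?T = "local_tracks (a # (l, d) # s)"
  have "?T ([Min 2 l d, Cross 1 t, Max 2, Cross 0 v], 1) ([Min 2 l d, Cross 1 t, Cross 0 v, Max 2], 1)"
    by (rule backward[OF local_move.exchange[of "Cross 0 v" "Max 0"],
        of "[Min 2 l d, Cross 1 t]" "[]"])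
      (auto simp: corr_iff numeral_eq_Suc)
  also have "?T \<dots> ([Min 2 l d, Cross 1 t, Cross 0 v, Cross 1 v, Cross 1 (flip v), Max 2], 1)"
    by (rule forward[OF local_move.bigon[OF refl, of "v" "1"],
        of "[Min 2 l d, Cross 1 t, Cross 0 v]" "[Max 2]"])
      (auto simp: corr_iff numeral_eq_Suc)
  also have "?T \<dots> ([Min 2 l d, Cross 1 t, Cross 0 v, Cross 1 v, Cross 2 v, Max 1], 1)"
    by (rule backward[OF local_move.rotate_max[of "1" "v"],
        of "[Min 2 l d, Cross 1 t, Cross 0 v, Cross 1 v]" "[]"])
      (auto simp: corr_iff numeral_eq_Suc)
  \<comment> \<open>The other strand is now the leftmost of the triangle, hence the second form of
    \<open>triangle_classical\<close>.\<close>
  also have "?T \<dots> ([Min 2 l d, Cross 0 v, Cross 1 v, Cross 0 t, Cross 2 v, Max 1], 3)"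
    by (rule backward[OF local_move.triangle[OF triangle_classical(2)[OF assms, of v], of "0"],
        of "[Min 2 l d]" "[Cross 2 v, Max 1]"])
      (auto simp: corr_iff numeral_eq_Suc)
  also have "?T \<dots> ([Min 2 l d, Cross 0 v, Cross 1 v, Cross 2 v, Cross 0 t, Max 1], 4)"
    by (rule forward[OF local_move.exchange[of "Cross 0 t" "Cross 0 v"],
        of "[Min 2 l d, Cross 0 v, Cross 1 v]" "[Max 1]"])
      (auto simp: corr_iff numeral_eq_Suc)
  also have "?T \<dots> ([Cross 0 v, Min 2 l d, Cross 1 v, Cross 2 v, Cross 0 t, Max 1], 4)"
    by (rule backward[OF local_move.exchange[of "Cross 0 v" "Min 0 l d"],
        of "[]" "[Cross 1 v, Cross 2 v, Cross 0 t, Max 1]"])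
      (auto simp: corr_iff numeral_eq_Suc)
  also have "?T \<dots> ([Cross 0 v, Min 1 l d, Cross 2 (flip v), Cross 2 v, Cross 0 t, Max 1], 4)"
    by (rule backward[OF local_move.rotate_min[of "1" l "d" "flip v"],
        of "[Cross 0 v]" "[Cross 2 v, Cross 0 t, Max 1]"])
      (auto simp: corr_iff numeral_eq_Suc)
  also have "?T \<dots> ([Cross 0 v, Min 1 l d, Cross 0 t, Max 1], 2)"
    by (rule backward[OF local_move.bigon[OF refl, of "flip v" "2"],
        of "[Cross 0 v, Min 1 l d]" "[Cross 0 t, Max 1]"])
      (auto simp: corr_iff numeral_eq_Suc)
  finally show ?thesis .
qed

lemma slide_left_kink_left:
  assumes "t \<noteq> Virtual"
  shows "local_tracks (a # (l, d) # s)
    ([Min 1 l (\<not> d), Cross 2 t, Max 1, Cross 0 v], 1)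
    ([Cross 0 v, Min 0 l (\<not> d), Cross 1 t, Max 0], 2)"
proof -
  let ?T = "local_tracks (a # (l, d) # s)"
  have "?T ([Min 1 l (\<not> d), Cross 2 t, Max 1, Cross 0 v], 1)
      ([Min 1 l (\<not> d), Cross 2 t, Cross 0 v, Cross 0 (flip v), Max 1, Cross 0 v], 1)"
    by (rule forward[OF local_move.bigon[OF refl, of "v" "0"],
        of "[Min 1 l (\<not> d), Cross 2 t]" "[Max 1, Cross 0 v]"])
      (auto simp: corr_iff numeral_eq_Suc)
  also have "?T \<dots> ([Min 1 l (\<not> d), Cross 2 t, Cross 0 v, Cross 1 v, Max 0, Cross 0 v], 1)"
    by (rule backward[OF local_move.rotate_max[of "0" "v"],
        of "[Min 1 l (\<not> d), Cross 2 t, Cross 0 v]" "[Cross 0 v]"])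
      (auto simp: corr_iff numeral_eq_Suc)
  also have "?T \<dots> ([Min 1 l (\<not> d), Cross 2 t, Cross 0 v, Cross 1 v, Cross 2 v, Max 0], 1)"
    by (rule forward[OF local_move.exchange[of "Max 0" "Cross 0 v"],
        of "[Min 1 l (\<not> d), Cross 2 t, Cross 0 v, Cross 1 v]" "[]"])
      (auto simp: corr_iff numeral_eq_Suc)
  also have "?T \<dots> ([Min 1 l (\<not> d), Cross 0 v, Cross 2 t, Cross 1 v, Cross 2 v, Max 0], 2)"
    by (rule backward[OF local_move.exchange[of "Cross 0 v" "Cross 0 t"],
        of "[Min 1 l (\<not> d)]" "[Cross 1 v, Cross 2 v, Max 0]"])
      (auto simp: corr_iff numeral_eq_Suc)
  also have "?T \<dots> ([Min 1 l (\<not> d), Cross 0 v, Cross 1 v, Cross 2 v, Cross 1 t, Max 0], 4)"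
    by (rule backward[OF local_move.triangle[OF triangle_classical(2)[OF assms, of v], of "1"],
        of "[Min 1 l (\<not> d), Cross 0 v]" "[Max 0]"])
      (auto simp: corr_iff numeral_eq_Suc)
  also have "?T \<dots> ([Min 0 l (\<not> d), Cross 1 (flip v), Cross 1 v, Cross 2 v, Cross 1 t, Max 0], 4)"
    by (rule backward[OF local_move.rotate_min[of "0" l "\<not> d" "flip v"],
        of "[]" "[Cross 1 v, Cross 2 v, Cross 1 t, Max 0]"])
      (auto simp: corr_iff numeral_eq_Suc)
  also have "?T \<dots> ([Min 0 l (\<not> d), Cross 2 v, Cross 1 t, Max 0], 2)"
    by (rule backward[OF local_move.bigon[OF refl, of "flip v" "1"],
        of "[Min 0 l (\<not> d)]" "[Cross 2 v, Cross 1 t, Max 0]"])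
      (auto simp: corr_iff numeral_eq_Suc)
  also have "?T \<dots> ([Cross 0 v, Min 0 l (\<not> d), Cross 1 t, Max 0], 2)"
    by (rule forward[OF local_move.exchange[of "Min 0 l (\<not> d)" "Cross 0 v"],
        of "[]" "[Cross 1 t, Max 0]"])
      (auto simp: corr_iff numeral_eq_Suc)
  finally show ?thesis .
qed

section \<open>Turning a kink over a maximum or a minimum\<close>

lemma turn_inner_kink_max:
  shows "local_tracks ((l, d) # (l, \<not> d) # s)
    ([Min 1 l d, Cross 0 t, Max 1, Max 0], 1)
    ([Min 1 l d, Cross 2 t, Max 1, Max 0], 1)"
proof -
  let ?T = "local_tracks ((l, d) # (l, \<not> d) # s)"
  \<comment> \<open>The crossing is rotated once at each of the two maxima; both rotations flip it,
    so it ends with its old type.\<close>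
  have "?T ([Min 1 l d, Cross 0 t, Max 1, Max 0], 1) ([Min 1 l d, Cross 1 (flip t), Max 0, Max 0], 1)"
    by (rule backward[OF local_move.rotate_max[of "0" "flip t"],
        of "[Min 1 l d]" "[Max 0]"])
      (auto simp: corr_iff numeral_eq_Suc)
  also have "?T \<dots> ([Min 1 l d, Cross 1 (flip t), Max 2, Max 0], 1)"
    by (rule forward[OF local_move.exchange[of "Max 0" "Max 0"],
        of "[Min 1 l d, Cross 1 (flip t)]" "[]"])
      (auto simp: corr_iff numeral_eq_Suc)
  also have "?T \<dots> ([Min 1 l d, Cross 2 t, Max 1, Max 0], 1)"
    by (rule backward[OF local_move.rotate_max[of "1" "t"],
        of "[Min 1 l d]" "[Max 0]"])
      (auto simp: corr_iff numeral_eq_Suc)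
  finally show ?thesis .
qed

text \<open>A kink outside an arch is isotopic to one crossing of the two legs below the maximum.
  Kinks on either outer side lead to the same form, which connects them in
  \<open>kink_turns_max\<close>.\<close>

lemma untwist_left_kink_max:
  shows "local_tracks ((l, d) # (l, \<not> d) # s)
    ([Min 0 l (\<not> d), Cross 1 t, Max 0, Max 0], 1)
    ([Cross 0 (flip t), Max 0], 0)"
proof -
  let ?T = "local_tracks ((l, d) # (l, \<not> d) # s)"
  have "?T ([Min 0 l (\<not> d), Cross 1 t, Max 0, Max 0], 1)
      ([Min 0 l (\<not> d), Cross 1 t, Max 2, Max 0], 1)"
    by (rule forward[OF local_move.exchange[of "Max 0" "Max 0"],
        of "[Min 0 l (\<not> d), Cross 1 t]" "[]"])
      (auto simp: corr_iff numeral_eq_Suc)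
  also have "?T \<dots> ([Min 0 l (\<not> d), Cross 2 (flip t), Max 1, Max 0], 1)"
    by (rule backward[OF local_move.rotate_max[of "1" "flip t"],
        of "[Min 0 l (\<not> d)]" "[Max 0]"])
      (auto simp: corr_iff numeral_eq_Suc)
  also have "?T \<dots> ([Cross 0 (flip t), Min 0 l (\<not> d), Max 1, Max 0], 0)"
    by (rule forward[OF local_move.exchange[of "Min 0 l (\<not> d)" "Cross 0 (flip t)"],
        of "[]" "[Max 1, Max 0]"])
      (auto simp: corr_iff numeral_eq_Suc)
  also have "?T \<dots> ([Cross 0 (flip t), Max 0], 0)"
    by (rule backward[OF local_move.zigzag_left[of "0" l "\<not> d"], of "[Cross 0 (flip t)]" "[Max 0]"])
      (auto simp: corr_iff numeral_eq_Suc)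
  finally show ?thesis .
qed

lemma untwist_right_kink_max:
  shows "local_tracks ((l, d) # (l, \<not> d) # s)
    ([Min 2 l (\<not> d), Cross 1 t, Max 2, Max 0], 1)
    ([Cross 0 (flip t), Max 0], 0)"
proof -
  let ?T = "local_tracks ((l, d) # (l, \<not> d) # s)"
  have "?T ([Min 2 l (\<not> d), Cross 1 t, Max 2, Max 0], 1)
      ([Min 2 l (\<not> d), Cross 1 t, Max 0, Max 0], 1)"
    by (rule backward[OF local_move.exchange[of "Max 0" "Max 0"],
        of "[Min 2 l (\<not> d), Cross 1 t]" "[]"])
      (auto simp: corr_iff numeral_eq_Suc)
  also have "?T \<dots> ([Min 2 l (\<not> d), Cross 0 (flip t), Max 1, Max 0], 1)"
    by (rule forward[OF local_move.rotate_max[of "0" "t"],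
        of "[Min 2 l (\<not> d)]" "[Max 0]"])
      (auto simp: corr_iff numeral_eq_Suc)
  also have "?T \<dots> ([Cross 0 (flip t), Min 2 l (\<not> d), Max 1, Max 0], 0)"
    by (rule backward[OF local_move.exchange[of "Cross 0 (flip t)" "Min 0 l (\<not> d)"],
        of "[]" "[Max 1, Max 0]"])
      (auto simp: corr_iff numeral_eq_Suc)
  also have "?T \<dots> ([Cross 0 (flip t), Max 0], 0)"
    by (rule backward[OF local_move.zigzag_right[of "1" l "\<not> d"],
        of "[Cross 0 (flip t)]" "[Max 0]"])
      (auto simp: corr_iff numeral_eq_Suc)
  finally show ?thesis .
qed

lemma turn_inner_kink_min:
  shows "local_tracks (s)
    ([Min 0 l d, Min 1 l d, Cross 0 t, Max 1], 2)
    ([Min 0 l d, Min 1 l d, Cross 2 t, Max 1], 2)"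
proof -
  let ?T = "local_tracks (s)"
  have "?T ([Min 0 l d, Min 1 l d, Cross 0 t, Max 1], 2)
      ([Min 0 l d, Min 0 l d, Cross 1 (flip t), Max 1], 2)"
    by (rule backward[OF local_move.rotate_min[of "0" l "d" "flip t"],
        of "[Min 0 l d]" "[Max 1]"])
      (auto simp: corr_iff numeral_eq_Suc)
  also have "?T \<dots> ([Min 0 l d, Min 2 l d, Cross 1 (flip t), Max 1], 2)"
    by (rule backward[OF local_move.exchange[of "Min 0 l d" "Min 0 l d"],
        of "[]" "[Cross 1 (flip t), Max 1]"])
      (auto simp: corr_iff numeral_eq_Suc)
  also have "?T \<dots> ([Min 0 l d, Min 1 l d, Cross 2 t, Max 1], 2)"
    by (rule backward[OF local_move.rotate_min[of "1" l "d" "t"],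
        of "[Min 0 l d]" "[Max 1]"])
      (auto simp: corr_iff numeral_eq_Suc)
  finally show ?thesis .
qed

text \<open>In the common form the crossing above the minimum swaps the legs, so the minimum has the
  opposite direction \<open>\<not> d\<close>.\<close>

lemma untwist_left_kink_min:
  shows "local_tracks (s)
    ([Min 0 l d, Min 0 l (\<not> d), Cross 1 t, Max 0], 2)
    ([Min 0 l (\<not> d), Cross 0 (flip t)], 1)"
proof -
  let ?T = "local_tracks (s)"
  have "?T ([Min 0 l d, Min 0 l (\<not> d), Cross 1 t, Max 0], 2)
      ([Min 0 l (\<not> d), Min 2 l d, Cross 1 t, Max 0], 2)"
    by (rule backward[OF local_move.exchange[of "Min 0 l (\<not> d)" "Min 0 l d"],
        of "[]" "[Cross 1 t, Max 0]"])
      (auto simp: corr_iff numeral_eq_Suc)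
  also have "?T \<dots> ([Min 0 l (\<not> d), Min 1 l d, Cross 2 (flip t), Max 0], 2)"
    by (rule backward[OF local_move.rotate_min[of "1" l "d" "flip t"],
        of "[Min 0 l (\<not> d)]" "[Max 0]"])
      (auto simp: corr_iff numeral_eq_Suc)
  also have "?T \<dots> ([Min 0 l (\<not> d), Min 1 l d, Max 0, Cross 0 (flip t)], 3)"
    by (rule backward[OF local_move.exchange[of "Max 0" "Cross 0 (flip t)"],
        of "[Min 0 l (\<not> d), Min 1 l d]" "[]"])
      (auto simp: corr_iff numeral_eq_Suc)
  also have "?T \<dots> ([Min 0 l (\<not> d), Cross 0 (flip t)], 1)"
    by (rule backward[OF local_move.zigzag_right[of "0" l "d"],
        of "[Min 0 l (\<not> d)]" "[Cross 0 (flip t)]"])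
      (auto simp: corr_iff numeral_eq_Suc)
  finally show ?thesis .
qed

lemma untwist_right_kink_min:
  shows "local_tracks (s)
    ([Min 0 l d, Min 2 l (\<not> d), Cross 1 t, Max 2], 2)
    ([Min 0 l (\<not> d), Cross 0 (flip t)], 1)"
proof -
  let ?T = "local_tracks (s)"
  have "?T ([Min 0 l d, Min 2 l (\<not> d), Cross 1 t, Max 2], 2)
      ([Min 0 l (\<not> d), Min 0 l d, Cross 1 t, Max 2], 2)"
    by (rule forward[OF local_move.exchange[of "Min 0 l d" "Min 0 l (\<not> d)"],
        of "[]" "[Cross 1 t, Max 2]"])
      (auto simp: corr_iff numeral_eq_Suc)
  also have "?T \<dots> ([Min 0 l (\<not> d), Min 1 l d, Cross 0 (flip t), Max 2], 2)"
    by (rule forward[OF local_move.rotate_min[of "0" l "d" "t"],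
        of "[Min 0 l (\<not> d)]" "[Max 2]"])
      (auto simp: corr_iff numeral_eq_Suc)
  also have "?T \<dots> ([Min 0 l (\<not> d), Min 1 l d, Max 2, Cross 0 (flip t)], 3)"
    by (rule forward[OF local_move.exchange[of "Cross 0 (flip t)" "Max 0"],
        of "[Min 0 l (\<not> d), Min 1 l d]" "[]"])
      (auto simp: corr_iff numeral_eq_Suc)
  also have "?T \<dots> ([Min 0 l (\<not> d), Cross 0 (flip t)], 1)"
    by (rule backward[OF local_move.zigzag_left[of "1" l "d"],
        of "[Min 0 l (\<not> d)]" "[Cross 0 (flip t)]"])
      (auto simp: corr_iff numeral_eq_Suc)
  finally show ?thesis .
qed

subsection \<open>Kinks\<close>

text \<open>The direction of the minimum is forced: the leg next to the strand replaces it after the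
  crossing and must carry the same direction, so that the old strand can close up with the other leg
  at the maximum.\<close>

definition kink :: "bool \<Rightarrow> nat \<Rightarrow> strand \<Rightarrow> crossing_type \<Rightarrow> drawing" where
  "kink right p a t =
    (if right then [Min (p + 1) (fst a) (snd a), Cross p t, Max (p + 1)]
     else [Min p (fst a) (\<not> snd a), Cross (p + 1) t, Max p])"

text \<open>
  \<open>kinked D k p r t\<close> has an additional kink at the point \<open>(k, p)\<close> of \<open>D\<close>. The kink lies on the right
  of an upward strand and on the left of a downward strand iff \<open>r\<close>; together with \<open>t\<close> this fixes the
  rotation number of the kink and the order of its over- and underpass, which do not change when the
  kink slides along its component.
\<close>

definition kinked :: "drawing \<Rightarrow> nat \<Rightarrow> nat \<Rightarrow> bool \<Rightarrow> crossing_type \<Rightarrow> drawing" where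
  "kinked D k p r t =
    take k D @ kink (r = snd (level D k ! p)) p (level D k ! p) t @ drop k D"

lemma length_kink [simp]: "length (kink right p a t) = 3"
  by (simp add: kink_def)

lemma map_shift_kink: "map (shift n) (kink right p a t) = kink right (p + n) a t"
  by (simp add: kink_def)

lemma local_move_kink:
  "local_move (if t = Virtual then VRI else RI) [] (kink right p a t) {}"
  using local_move.kink_right[OF refl, of t p "fst a" "snd a"]
    local_move.kink_left[OF refl, of t p "fst a" "\<not> snd a"]
  by (simp add: kink_def)

lemma run_kink: "p < length s \<Longrightarrow> run (kink right p (s ! p) t) s = Some s"
proof -
  assume p: "p < length s"
  have "run (kink right 0 a t) (a # s') = Some (a # s')" for a s'
    by (cases a) (auto simp: kink_def)
  from this[of "s ! p" "drop (Suc p) s"] show ?thesis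
    using run_shift[of "take p s" p "kink right 0 (s ! p) t" "s ! p # drop (Suc p) s"] p
    by (simp add: map_shift_kink Cons_nth_drop_Suc)
qed

lemma kinked_diagram:
  assumes "diagram D" "(k, p) \<in> points D"
  shows "diagram (kinked D k p r t)"
proof -
  have kp: "k \<le> length D" "p < length (level D k)" using assms(2) by (auto simp: points_def)
  have run: "run (take k D) [] = Some (level D k)"
    using run_take_level[of D k] assms(1) by (auto simp: diagram_def)
  let ?K = "kink (r = snd (level D k ! p)) p (level D k ! p) t"
  have "replaceable [] ?K \<and> replaceable ?K []" using local_move_kink local_move_replaceable by blast
  then show ?thesis
    using diagram_replace[of "[]" ?K "take k D" "drop k D" "level D k"] run run_kink[OF kp(2)] assms(1)
    unfolding kinked_def by auto
qed

section \<open>A kink passing one event\<close>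

lemma exchange_forward:
  assumes "pos e \<le> pos f" "run (u @ [e, shift (strands_above e) f] @ z) s \<noteq> None"
    "(c, c') \<in> corr u [e, shift (strands_above e) f] [shift (strands_below e) f, e] {(0, 1), (1,
        0)}"
  shows "local_tracks s (u @ [e, shift (strands_above e) f] @ z, c) (u @ [shift (strands_below e) f,
      e] @ z, c')"
proof -
  have "run (u @ [shift (strands_below e) f, e] @ z) s \<noteq> None"
    using assms(2) unfolding run_append run_exchange[OF assms(1)] .
  then show ?thesis using forward[OF local_move.exchange[OF assms(1)] assms(2) _ assms(3) refl refl]
      by blast
qed

lemma exchange_backward:
  assumes "pos e \<le> pos f" "run (u @ [shift (strands_below e) f, e] @ z) s \<noteq> None"
    "(c', c) \<in> corr u [e, shift (strands_above e) f] [shift (strands_below e) f, e] {(0, 1), (1,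
        0)}"
  shows "local_tracks s (u @ [shift (strands_below e) f, e] @ z, c) (u @ [e, shift (strands_above e)
      f] @ z, c')"
proof -
  have "run (u @ [e, shift (strands_above e) f] @ z) s \<noteq> None"
    using assms(2) unfolding run_append run_exchange[OF assms(1)] .
  then show ?thesis using exchange_forward[OF assms(1) _ assms(3)] local_tracks_sym by blast
qed

lemma local_tracks_run: "local_tracks s X Y \<Longrightarrow> run (fst X) s \<noteq> None \<Longrightarrow> run (fst Y) s \<noteq> None"
  by (induction rule: rtranclp_induct) (auto elim: local_track.cases)

lemma commute_right:
  assumes "i \<le> pos e" "j \<le> pos e" "k \<le> pos e" "run [Min i l d, Cross j t, Max k, e] s \<noteq> None"
  shows "local_tracks s ([Min i l d, Cross j t, Max k, e], 1) ([e, Min i l d, Cross j t, Max k], 2)"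
proof -
  let ?T = "local_tracks s"
  have 1: "?T ([Min i l d, Cross j t, Max k, e], 1) ([Min i l d, Cross j t, shift 2 e, Max k], 1)"
    using exchange_forward[of "Max k" e "[Min i l d, Cross j t]" "[]" s 1 1] assms by (simp add:
        corr_iff)
  have 2: "?T ([Min i l d, Cross j t, shift 2 e, Max k], 1) ([Min i l d, shift 2 e, Cross j t, Max
      k], 2)"
    using exchange_forward[of "Cross j t" e "[Min i l d]" "[Max k]" s 1 2] assms local_tracks_run[OF 1]
    by (simp add: corr_iff)
  have "?T ([Min i l d, shift 2 e, Cross j t, Max k], 2) ([e, Min i l d, Cross j t, Max k], 2)"
    using exchange_forward[of "Min i l d" e "[]" "[Cross j t, Max k]" s 2 2] assms
      local_tracks_run[OF 2] local_tracks_run[OF 1] by (simp add: corr_iff)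
  with 1 2 show ?thesis by (meson rtranclp_trans)
qed

text \<open>The event lies to the left of the kink, whose positions are therefore counted with the
  strands of \<open>e\<close> below it at first and with those above it afterwards.\<close>

lemma commute_left:
  assumes "pos e \<le> pos f1" "pos e \<le> pos f2" "pos e \<le> pos f3" "a = strands_above e" "b =
      strands_below e"
    "run [shift b f1, shift b f2, shift b f3, e] s \<noteq> None"
  shows "local_tracks s ([shift b f1, shift b f2, shift b f3, e], 1)
    ([e, shift a f1, shift a f2, shift a f3], 2)"
proof -
  let ?T = "local_tracks s"
  have 1: "?T ([shift b f1, shift b f2, shift b f3, e], 1) ([shift b f1, shift b f2, e, shift a f3], 1)"
    using exchange_backward[of e f3 "[shift b f1, shift b f2]" "[]" s 1 1] assms by (simp add: corr_iff)
  have 2: "?T ([shift b f1, shift b f2, e, shift a f3], 1) ([shift b f1, e, shift a f2, shift a f3], 2)"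
    using exchange_backward[of e f2 "[shift b f1]" "[shift a f3]" s 2 1] assms local_tracks_run[OF 1]
    by (simp add: corr_iff)
  have "?T ([shift b f1, e, shift a f2, shift a f3], 2) ([e, shift a f1, shift a f2, shift a f3], 2)"
    using exchange_backward[of e f1 "[]" "[shift a f2, shift a f3]" s 2 2] assms
      local_tracks_run[OF 2] local_tracks_run[OF 1] by (simp add: corr_iff)
  with 1 2 show ?thesis by (meson rtranclp_trans)
qed

text \<open>The strand runs to the left of the event, to its right, or through a crossing in one of
  two directions. In the second case \<open>p0\<close> is the position with the strands of the event
  left out.\<close>

lemma passes_cases:
  assumes "passes e p q"
  obtains "p < pos e" "q = p" | p0 where "pos e \<le> p0" "p = p0 + strands_below e" "q = p0 +
      strands_above e"
    | v where "e = Cross p v" "q = p + 1" | v where "e = Cross q v" "p = q + 1"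
proof (cases e)
  case (Min i l d)
  then show ?thesis using assms that(1) that(2)[of p] by auto
next
  case (Max i)
  then show ?thesis using assms that(1) that(2)[of q] by auto
next
  case (Cross i t)
  then have "q = (if p = i then i + 1 else if p = i + 1 then i else p)" using assms by simp
  then consider "p < i" "q = p" | "i + 2 \<le> p" "q = p" | "p = i" "q = i + 1" | "p = i + 1" "q = i"
    by (metis add_2_eq_Suc' Suc_eq_plus1 not_less_eq_eq linorder_neqE_nat Suc_leI le_antisym not_less)
  then show ?thesis
  proof cases
    case 2
    then show ?thesis using that(2)[of "p - 2"] Cross by simp
  next
    case 1
    then show ?thesis using Cross by (intro that(1)) simp_all
  next
    case 3
    then show ?thesis using Cross by (intro that(3)) simp_all
  next
    case 4
    then show ?thesis using Cross by (intro that(4)) simp_all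
  qed
qed

text \<open>Unless the strand itself runs through a crossing, kink and event are distant and three
  exchanges suffice. The crossing is event 1 of the kink and gets index 2 when \<open>e\<close>
  comes first.\<close>

lemma kink_passes:
  assumes t: "t \<noteq> Virtual" and e: "apply_event e s \<noteq> None" and p: "p < length s" and
      pq: "passes e p q"
  shows "local_tracks s (kink right p (s ! p) t @ [e], 1) (e # kink right q (s ! p) t, 2)"
proof -
  have run: "run (kink right p (s ! p) t @ [e]) s \<noteq> None"
    using e run_kink[OF p] by (simp add: run_append split: option.splits)
  obtain l d where a: "s ! p = (l, d)" by (cases "s ! p")
  show ?thesis
    using pq
  proof (cases rule: passes_cases)
    case 1
    then show ?thesis
      using run commute_right[of "p + 1" e p "p + 1" "fst (s ! p)" "snd (s ! p)" t s]
        commute_right[of p e "p + 1" p "fst (s ! p)" "\<not> snd (s ! p)" t s]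
      by (cases right) (simp_all add: kink_def del: run.simps)
  next
    case (2 p0)
    then show ?thesis
      using run commute_left[of e "kink right p0 (s ! p) t ! 0" "kink right p0 (s ! p) t ! 1"
          "kink right p0 (s ! p) t ! 2" "strands_above e" "strands_below e" s]
      by (auto simp: kink_def numeral_eq_Suc split: if_splits)
  next
    case (3 v)
    then have "p + 1 < length s" using e by (auto split: if_splits)
    then have s: "s = take p s @ (l, d) # s ! (p + 1) # drop (p + 2) s" and len: "length (take p s) = p"
      using split_two[of p s] a by auto
    show ?thesis
    proof (cases right)
      case True
      show ?thesis
        using local_tracks_shift[OF slide_right_kink_right[OF t, of l d "s ! (p + 1)" "drop (p + 2)
            s" v] len] 3 True a
        by (subst s) (simp add: kink_def)
    next
      case False
      show ?thesis
        using local_tracks_shift[OF slide_left_kink_right[OF t, of l d "s ! (p + 1)" "drop (p + 2) s"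
            v] len] 3 False a
        by (subst s) (simp add: kink_def)
    qed
  next
    case (4 v)
    then have "q + 1 < length s" using e by (auto split: if_splits)
    then have s: "s = take q s @ s ! q # (l, d) # drop (q + 2) s" and len: "length (take q s) = q"
      using split_two[of q s] a 4 by auto
    show ?thesis
    proof (cases right)
      case True
      show ?thesis
        using local_tracks_shift[OF slide_right_kink_left[OF t, of "s ! q" l d "drop (q + 2) s" v]
            len] 4 True a
        by (subst s) (simp add: kink_def)
    next
      case False
      show ?thesis
        using local_tracks_shift[OF slide_left_kink_left[OF t, of "s ! q" l d "drop (q + 2) s" v]
            len] 4 False a
        by (subst s) (simp add: kink_def)
    qed
  qed
qed

text \<open>The strand turns round at the maximum, so a kink on a fixed side of the directed strand
  changes its side in the picture. It stays between the legs if \<open>right\<close>, and outside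
  the arch otherwise.\<close>

lemma kink_turns_max:
  assumes "apply_event (Max i) s \<noteq> None"
  shows "local_tracks s (kink right i (s ! i) t @ [Max i], 1) (kink (\<not> right) (i + 1) (s ! (i +
      1)) t @ [Max i], 1)"
proof -
  obtain l d where a: "s ! i = (l, d)" by (cases "s ! i")
  have i: "i + 1 < length s" and b: "s ! (i + 1) = (l, \<not> d)"
    using assms a by (auto split: if_splits simp: prod_eq_iff)
  have s: "s = take i s @ (l, d) # (l, \<not> d) # drop (i + 2) s" and len: "length (take i s) = i"
    using split_two[of i s] a b i by auto
  let ?X = "([Min 1 l d, Cross 0 t, Max 1, Max 0], 1)" and ?Y = "([Min 1 l d, Cross 2 t, Max 1, Max
      0], 1)"
  let ?X' = "([Min 0 l (\<not> d), Cross 1 t, Max 0, Max 0], 1)" and ?Y' = "([Min 2 l (\<not> d),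
      Cross 1 t, Max 2, Max 0], 1)"
  let ?s = "(l, d) # (l, \<not> d) # drop (i + 2) s"
  have outer: "local_tracks ?s ?X' ?Y'"
    using untwist_left_kink_max local_tracks_sym[OF untwist_right_kink_max] by (rule rtranclp_trans)
  show ?thesis
    unfolding a b
    using local_tracks_shift[OF outer len] local_tracks_shift[OF turn_inner_kink_max[of l d "drop (i
        + 2) s" t] len] 
    by (subst s) (auto simp: kink_def)
qed

lemma kink_turns_min:
  assumes "i \<le> length s"
  shows "local_tracks s (Min i l d # kink right i (l, d) t, 2) (Min i l d # kink (\<not> right) (i +
      1) (l, \<not> d) t, 2)"
proof -
  have s: "s = take i s @ drop i s" and len: "length (take i s) = i" using assms by auto
  let ?X' = "([Min 0 l d, Min 0 l (\<not> d), Cross 1 t, Max 0], 2)" and ?Y' = "([Min 0 l d, Min 2 l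
      (\<not> d), Cross 1 t, Max 2], 2)"
  have outer: "local_tracks (drop i s) ?X' ?Y'"
    using untwist_left_kink_min local_tracks_sym[OF untwist_right_kink_min] by (rule rtranclp_trans)
  show ?thesis
    using local_tracks_shift[OF outer len] local_tracks_shift[OF turn_inner_kink_min[of "drop i s" l
        d t] len] 
    by (subst s) (auto simp: kink_def)
qed

text \<open>A kink at level \<open>k\<close> occupies the events \<open>k\<close> to
  \<open>k + 2\<close>, hence the index \<open>k + 1\<close> of its crossing.\<close>

lemma kink_slides:
  assumes D: "diagram D" and t: "t \<noteq> Virtual" and j: "joined D a b"
  shows "track\<^sup>*\<^sup>* (kinked D (fst a) (snd a) r t, fst a + 1) (kinked D (fst b) (snd b) r
      t, fst b + 1)"
proof -
  have ok: "run D [] \<noteq> None" using D by (auto simp: diagram_def)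
  have pts: "a \<in> points D" using joined_points[OF ok j] by simp
  have lift: "track\<^sup>*\<^sup>* (take k D @ X @ drop (k + 1) D, k + c) (take k D @ Y @ drop (k +
      1) D, k + c')"
    if "local_tracks (level D k) (X, c) (Y, c')" "take k D @ X @ drop (k + 1) D = kinked D (fst a)
        (snd a) r t"
      "k < length D" for k X Y c c'
    using local_tracks_lift[OF that(1) run_take_level[OF ok, of k], of "drop (k + 1) D"] that(2,3)
      kinked_diagram[OF D, of "fst a" "snd a"] pts by simp
  have split: "take (k + 1) D = take k D @ [D ! k]" "drop k D = D ! k # drop (k + 1) D" if "k <
      length D" for k
    using that by (simp_all add: take_Suc_conv_app_nth Cons_nth_drop_Suc)
  \<comment> \<open>The legs of an extremum have opposite directions, so changing the side in the
    picture is the same as keeping \<open>r\<close>.\<close>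
  have neg: "(\<not> r = x) = (r = (\<not> x))" for x by auto
  show ?thesis
    using j
  proof cases
    case (1 k i l d)
    have lev: "apply_event (Min i l d) (level D k) = Some (level D (k + 1))" using level_Suc[OF ok,
        of k] 1 by simp
    note n = Min_nth[OF lev]
    have "i \<le> length (level D k)" using lev by (auto split: if_splits)
    from kink_turns_min[OF this, of l d "r = d" t]
    have "local_tracks (level D k) (Min i l d # kink (r = d) i (l, d) t, 2)
      (Min i l d # kink (r = (\<not> d)) (i + 1) (l, \<not> d) t, 2)" unfolding neg .
    from lift[OF this] show ?thesis using 1 n split(1)[of k] by (simp add: kinked_def)
  next
    case (2 k i)
    have "apply_event (Max i) (level D k) = Some (level D (k + 1))" using level_Suc[OF ok, of k] 2 by
        simp
    note lev = this Max_nth[OF this]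
    then have n: "snd (level D k ! (i + 1)) = (\<not> snd (level D k ! i))" by blast
    have lev: "apply_event (Max i) (level D k) \<noteq> None" unfolding lev(1) by simp
    have "local_tracks (level D k) (kink (r = snd (level D k ! i)) i (level D k ! i) t @ [Max i], 1)
      (kink (r = snd (level D k ! (i + 1))) (i + 1) (level D k ! (i + 1)) t @ [Max i], 1)"
      using kink_turns_max[OF lev, of "r = snd (level D k ! i)" t] unfolding n neg .
    from lift[OF this] show ?thesis using 2 split(2)[of k] by (simp add: kinked_def)
  next
    case (3 k p q)
    have lev: "apply_event (D ! k) (level D k) = Some (level D (k + 1))" using level_Suc[OF ok, of k]
        3 by simp
    have p: "p < length (level D k)" using 3 by (auto simp: points_def)
    have n: "level D (k + 1) ! q = level D k ! p" using passes_nth[OF lev p 3(5)] by simp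
    have "local_tracks (level D k) (kink (r = snd (level D k ! p)) p (level D k ! p) t @ [D ! k], 1)
      (D ! k # kink (r = snd (level D k ! p)) q (level D k ! p) t, 2)"
      using kink_passes[OF t _ p 3(5)] lev by simp
    from lift[OF this] show ?thesis using 3 split[of k] n by (simp add: kinked_def)
  qed
qed

lemma kink_slides_component:
  assumes D: "diagram D" and t: "t \<noteq> Virtual" and "a \<in> points D" "b \<in> points D"
      "point_label D a = point_label D b"
  shows "track\<^sup>*\<^sup>* (kinked D (fst a) (snd a) r t, fst a + 1) (kinked D (fst b) (snd b) r
      t, fst b + 1)"
proof -
  have "equivclp (joined D) a b" using assms by (auto simp: diagram_def)
  then show ?thesis
  proof (induction rule: equivclp_induct)
    case (step b c)
    then have "track\<^sup>*\<^sup>* (kinked D (fst b) (snd b) r t, fst b + 1) (kinked D (fst c) (snd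
        c) r t, fst c + 1)"
      using kink_slides[OF D t] tracks_sym by blast
    with step.IH show ?case by (rule rtranclp_trans)
  qed auto
qed

section \<open>Moves and crossing changes away from a kink\<close>

lemma run_list_update:
  "apply_event e = apply_event (D ! j) \<Longrightarrow> run (D[j := e]) s = run D s"
proof (induction D arbitrary: j s)
  case (Cons a D)
  then show ?case by (cases j) (auto split: option.split)
qed simp

lemma apply_event_flip [simp]: "apply_event (flip_event e) = apply_event e"
  by (cases e) (auto simp: fun_eq_iff)

lemma level_crossing_change [simp]: "level (crossing_change D j) k = level D k"
proof -
  have "run (take k (D[j := flip_event (D ! j)])) [] = run (take k D) []"
    by (cases "j < k") (simp_all add: take_update_swap run_list_update list_update_beyond)
  then show ?thesis by (simp add: level_def crossing_change_def)
qed

lemma length_crossing_change [simp]: "length (crossing_change D j) = length D"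
  by (simp add: crossing_change_def)

lemmas level_flip_event [simp] = level_crossing_change[unfolded crossing_change_def]

lemma points_crossing_change [simp]: "points (crossing_change D j) = points D"
  by (simp add: points_def)

text \<open>The kink inserts three events, hence \<open>j + 3\<close>.\<close>

lemma kinked_crossing_change:
  assumes "k \<le> length D" "j < length D"
  shows "kinked (crossing_change D j) k p r t =
    crossing_change (kinked D k p r t) (if j < k then j else j + 3)"
proof (cases "j < k")
  case True
  then show ?thesis using assms
    by (simp add: kinked_def crossing_change_def list_update_append1 nth_append take_update_swap)
next
  case False
  then obtain i where "j = k + i" by (metis le_Suc_ex not_less)
  then show ?thesis using assms
    by (simp add: kinked_def crossing_change_def list_update_append nth_append drop_update_swap
        take_update_swap list_update_beyond)
qed

lemma crossing_kinked:
  assumes "k \<le> length D" "j \<in> crossings D"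
  shows "(if j < k then j else j + 3) \<in> crossings (kinked D k p r t)"
  using assms by (auto simp: crossings_def kinked_def nth_append)

text \<open>If the kink sits inside the fragment, it first slides along its component to a level
  outside. Then the same move applies, with the kink as a part of \<open>u\<close> or of
  \<open>z\<close>.\<close>

lemma generalized_reidemeister_kinked:
  assumes "move m u z x y K" "(k, p) \<in> points (u @ x @ z)" "t \<noteq> Virtual"
  shows "\<exists>k' p'. (k', p') \<in> points (u @ y @ z) \<and>
    track\<^sup>*\<^sup>* (kinked (u @ x @ z) k p r t, k + 1) (kinked (u @ y @ z) k' p' r t, k' + 1)"
proof -
  let ?D = "u @ x @ z" and ?D' = "u @ y @ z"
  have D: "diagram ?D" and D': "diagram ?D'" using assms(1) by (auto simp: move_def)
  then have ok: "run ?D [] = Some []" "run ?D' [] = Some []" by (auto simp: diagram_def)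
  obtain s where s: "run u [] = Some s" using ok by (auto simp: run_append_Some)
  obtain q where q: "run x s = Some q" "run z q = Some []" using ok s by (auto simp: run_append_Some)
  have "replaceable y x" using assms(1) local_move_replaceable by (auto simp: move_def)
  moreover have "run y s \<noteq> None" using ok s by (auto simp: run_append_Some)
  ultimately have y: "run y s = Some q" and lab: "labels x \<subseteq> fst ` set s \<union> fst ` set q"
    using replaceableD[OF _ q(1)] by blast+
  have lev_u: "level ?D k = level ?D' k" if "k \<le> length u" for k
    using that by (simp add: level_append)
  have lev_x: "level ?D (length u + j) = the (run (take j x) s)" if "j \<le> length x" for j
    using that level_append_right[OF s, of "x @ z" j] by simp
  have lev_z: "level ?D (length u + length x + j) = the (run (take j z) q)"
    "level ?D' (length u + length y + j) = the (run (take j z) q)" for j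
    using s q y by (simp_all add: level_def run_append)
  \<comment> \<open>A point of the same component that is not strictly inside the fragment; it
    exists because the labels in \<open>x\<close> occur on its boundary.\<close>
  obtain k1 p1 where kp1: "(k1, p1) \<in> points ?D" "point_label ?D (k1, p1) = point_label ?D (k, p)"
    "k1 \<le> length u \<or> length u + length x \<le> k1"
  proof (cases "k \<le> length u \<or> length u + length x \<le> k")
    case False
    then obtain j where j: "k = length u + j" "j \<le> length x"
      by (metis le_Suc_ex linear nat_add_left_cancel_le)
    have p: "p < length (level ?D k)" using assms(2) by (simp add: points_def)
    have "run (take j x) s = Some (level ?D k)"
      using run_take[of x s j] q lev_x[OF j(2)] j by auto
    then have "fst ` set (level ?D k) \<subseteq> fst ` set s \<union> labels x"
      using run_labels labels_take[of j x] by blast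
    moreover have "point_label ?D (k, p) \<in> fst ` set (level ?D k)" using p by (simp add:
        point_label_def)
    ultimately consider "point_label ?D (k, p) \<in> fst ` set s" | "point_label ?D (k, p) \<in> fst
        ` set q"
      using lab by blast
    then show ?thesis
    proof cases
      case 1
      then obtain p1 where "p1 < length s" "fst (s ! p1) = point_label ?D (k, p)"
        by (metis imageE in_set_conv_nth)
      moreover have "level ?D (length u) = s" using lev_x[of 0] by simp
      ultimately show ?thesis by (intro that[of "length u" p1]) (auto simp: points_def point_label_def)
    next
      case 2
      then obtain p1 where "p1 < length q" "fst (q ! p1) = point_label ?D (k, p)"
        by (metis imageE in_set_conv_nth)
      moreover have "level ?D (length u + length x) = q" using lev_x[of "length x"] q by simp
      ultimately show ?thesis
        by (intro that[of "length u + length x" p1]) (auto simp: points_def point_label_def)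
    qed
  qed (use assms(2) that in auto)
  have 1: "track\<^sup>*\<^sup>* (kinked ?D k p r t, k + 1) (kinked ?D k1 p1 r t, k1 + 1)"
    using kink_slides_component[OF D assms(3,2) kp1(1) kp1(2)[symmetric], of r] by simp
  obtain k2 where k2: "(k2, p1) \<in> points ?D'" "track (kinked ?D k1 p1 r t, k1 + 1) (kinked ?D' k2
      p1 r t, k2 + 1)"
  proof (cases "k1 \<le> length u")
    case True
    have pt: "(k1, p1) \<in> points ?D'" using kp1(1) lev_u[OF True] True by (simp add: points_def)
    let ?u = "take k1 u @ kink (r = snd (level ?D k1 ! p1)) p1 (level ?D k1 ! p1) t @ drop k1 u"
    have eq: "kinked ?D k1 p1 r t = ?u @ x @ z" "kinked ?D' k1 p1 r t = ?u @ y @ z"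
      using True lev_u[OF True] by (simp_all add: kinked_def)
    have "move m ?u z x y K"
      using assms(1) kinked_diagram[OF D kp1(1), of r t] kinked_diagram[OF D' pt, of r t]
      unfolding move_def eq by blast
    moreover have "(k1 + 1, k1 + 1) \<in> corr ?u x y K" using True by (simp add: corr_iff)
    ultimately show ?thesis using that[OF pt] track.move eq by metis
  next
    case False
    then obtain j where j: "k1 = length u + length x + j" using kp1(3) le_Suc_ex by blast
    \<comment> \<open>Above the fragment the levels are renumbered by the change of its
      length.\<close>
    let ?k2 = "length u + length y + j"
    have pt: "(?k2, p1) \<in> points ?D'" using kp1(1) lev_z[of j] j by (simp add: points_def)
    let ?z = "take j z @ kink (r = snd (level ?D k1 ! p1)) p1 (level ?D k1 ! p1) t @ drop j z"
    have eq: "kinked ?D k1 p1 r t = u @ x @ ?z" "kinked ?D' ?k2 p1 r t = u @ y @ ?z"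
      using j lev_z[of j] by (simp_all add: kinked_def)
    have "move m u ?z x y K"
      using assms(1) kinked_diagram[OF D kp1(1), of r t] kinked_diagram[OF D' pt, of r t]
      unfolding move_def eq by blast
    moreover have "(k1 + 1, ?k2 + 1) \<in> corr u x y K" using j by (simp add: corr_iff)
    ultimately show ?thesis using that[OF pt] track.move eq by metis
  qed
  show ?thesis using k2(1) rtranclp.rtrancl_into_rtrancl[OF 1 k2(2)] by blast
qed

lemma flat_step_kinked:
  assumes "flat_step D D'" "(k, p) \<in> points D" "t \<noteq> Virtual"
  shows "\<exists>k' p'. (k', p') \<in> points D' \<and> track\<^sup>*\<^sup>* (kinked D k p r t, k +
      1) (kinked D' k' p' r t, k' + 1)"
  using assms(1) unfolding flat_step_def
proof
  assume "generalized_reidemeister D D'"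
  then obtain m u z x y K where "move m u z x y K" "D = u @ x @ z" "D' = u @ y @ z"
    by (auto simp: generalized_reidemeister_def)
  then show ?thesis using generalized_reidemeister_kinked[of m u z x y K k p t r] assms(2,3) by simp
next
  assume "\<exists>j\<in>crossings D. D' = crossing_change D j"
  then obtain j where j: "j \<in> crossings D" "D' = crossing_change D j" by blast
  \<comment> \<open>The index of the changed crossing after insertion of the kink; it is never
    \<open>k + 1\<close>, the crossing of the kink.\<close>
  let ?j = "if j < k then j else j + 3"
  have k: "k \<le> length D" "j < length D" using assms(2) j by (auto simp: points_def crossings_def)
  have "track (kinked D k p r t, k + 1) (crossing_change (kinked D k p r t) ?j, k + 1)"
    by (rule track.change[OF crossing_kinked[OF k(1) j(1)]]) auto
  then have "track (kinked D k p r t, k + 1) (kinked D' k p r t, k + 1)"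
    unfolding j(2) kinked_crossing_change[OF k] .
  then show ?thesis using assms(2) j(2) by auto
qed

lemma flat_equiv_kinked:
  assumes "flat_equiv D D'" "(k, p) \<in> points D" "t \<noteq> Virtual"
  shows "\<exists>k' p'. (k', p') \<in> points D' \<and> track\<^sup>*\<^sup>* (kinked D k p r t, k +
      1) (kinked D' k' p' r t, k' + 1)"
  using assms(1) unfolding flat_equiv_def
proof (induction rule: rtranclp_induct)
  case base
  then show ?case using assms(2) by blast
next
  case (step D1 D2)
  then show ?case using flat_step_kinked[OF step.hyps(2) _ assms(3), of _ _ r] by (meson rtranclp_trans)
qed

section \<open>Removable crossings are crossings of kinks\<close>

lemma RI_fragment:
  assumes "move RI u z x [] K"
  shows "\<exists>i l d t. t \<noteq> Virtual \<and> (x = [Min (i + 1) l d, Cross i t, Max (i + 1)] \<or>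
    x = [Min i l d, Cross (i + 1) t, Max i])"
proof -
  have "local_move RI x [] K \<or> local_move RI [] x (K\<inverse>)" using assms by (simp add: move_def)
  then show ?thesis
  proof
    assume "local_move RI [] x (K\<inverse>)"
    then show ?thesis
    proof cases
      case (kink_right t i l d)
      then show ?thesis by (intro exI[of _ i] exI[of _ l] exI[of _ d] exI[of _ t]) (simp split:
          if_splits)
    next
      case (kink_left t i l d)
      then show ?thesis by (intro exI[of _ i] exI[of _ l] exI[of _ d] exI[of _ t]) (simp split:
          if_splits)
    qed (simp_all split: if_splits)
  qed (auto elim: local_move.cases)
qed

text \<open>The maximum closes the loop only if the strand has the label and the direction of the
  leg that replaces it.\<close>

lemma kink_strand:
  "run [Min (i + 1) l d, Cross i t, Max (i + 1)] s \<noteq> None \<Longrightarrow> i < length s \<and> s ! i = (l, d)"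
  "run [Min i l d, Cross (i + 1) t, Max i] s \<noteq> None \<Longrightarrow> i < length s \<and> s ! i = (l, \<not> d)"
proof -
  assume run: "run [Min (i + 1) l d, Cross i t, Max (i + 1)] s \<noteq> None"
  then have i: "i < length s" by (auto split: if_splits)
  then have s: "s = take i s @ s ! i # drop (Suc i) s" by (simp add: id_take_nth_drop)
  have "run (map (shift i) [Min 1 l d, Cross 0 t, Max 1]) (take i s @ s ! i # drop (Suc i) s)
      \<noteq> None"
    unfolding s[symmetric] using run by simp
  moreover have "run (map (shift i) [Min 1 l d, Cross 0 t, Max 1]) (take i s @ s ! i # drop (Suc i) s) =
      map_option ((@) (take i s)) (run [Min 1 l d, Cross 0 t, Max 1] (s ! i # drop (Suc i) s))"
    by (rule run_shift) (use i in simp)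
  ultimately have "run [Min 1 l d, Cross 0 t, Max 1] (s ! i # drop (Suc i) s) \<noteq> None" by
      (metis option.map(1))
  then show "i < length s \<and> s ! i = (l, d)" using i by (auto simp: prod_eq_iff split: if_splits)
next
  assume run: "run [Min i l d, Cross (i + 1) t, Max i] s \<noteq> None"
  then have i: "i < length s" by (auto split: if_splits)
  then have s: "s = take i s @ s ! i # drop (Suc i) s" by (simp add: id_take_nth_drop)
  have "run (map (shift i) [Min 0 l d, Cross 1 t, Max 0]) (take i s @ s ! i # drop (Suc i) s)
      \<noteq> None"
    unfolding s[symmetric] using run by simp
  moreover have "run (map (shift i) [Min 0 l d, Cross 1 t, Max 0]) (take i s @ s ! i # drop (Suc i) s) =
      map_option ((@) (take i s)) (run [Min 0 l d, Cross 1 t, Max 0] (s ! i # drop (Suc i) s))"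
    by (rule run_shift) (use i in simp)
  ultimately have "run [Min 0 l d, Cross 1 t, Max 0] (s ! i # drop (Suc i) s) \<noteq> None" by
      (metis option.map(1))
  then show "i < length s \<and> s ! i = (l, \<not> d)" using i by (auto simp: prod_eq_iff split: if_splits)
qed

lemma RI_removable_kinked:
  assumes "c \<in> RI_removable D"
  obtains D0 k p r t where "generalized_reidemeister D D0" "(k, p) \<in> points D0" "t \<noteq> Virtual"
    "D = kinked D0 k p r t" "c = k + 1"
proof -
  obtain u z x K where c: "c \<in> crossings D" "D = u @ x @ z" "move RI u z x [] K" "c \<in> span u x"
    using assms by (auto simp: RI_removable_def)
  have gr: "generalized_reidemeister D (u @ z)"
    using c(2,3) unfolding generalized_reidemeister_def by (metis append_Nil)
  obtain s where s: "run u [] = Some s" "run x s \<noteq> None"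
    using c(3) by (auto simp: move_def diagram_def run_append_Some)
  have lev: "level (u @ z) (length u) = s" using level_append_right[OF s(1), of z 0] by simp
  obtain i l d t where t: "t \<noteq> Virtual" and x: "x = [Min (i + 1) l d, Cross i t, Max (i + 1)] \<or>
    x = [Min i l d, Cross (i + 1) t, Max i]" using RI_fragment[OF c(3)] by blast
  have "c - length u < 3" "length u \<le> c" using c(4) x by (auto simp: span_def)
  moreover have "classical_event (x ! (c - length u))"
    using c x calculation by (auto simp: crossings_def nth_append)
  ultimately have ck: "c = length u + 1"
    using x by (auto simp: numeral_eq_Suc less_Suc_eq)
  show ?thesis
    using x
  proof
    assume x: "x = [Min (i + 1) l d, Cross i t, Max (i + 1)]"
    then have i: "i < length s" "s ! i = (l, d)" using kink_strand(1)[of i l d t s] s by auto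
    show ?thesis
      \<comment> \<open>The witness for \<open>r\<close> is \<open>d\<close> for both sides: here
        the strand has direction \<open>d\<close>, while for a left kink it has
        \<open>\<not> d\<close>, so that the comparison in \<open>kinked\<close> fails as it
        should.\<close>
      by (rule that[of "u @ z" "length u" i t d, OF gr _ t _ ck])
        (use i lev c(2) x in \<open>auto simp: points_def kinked_def kink_def\<close>)
  next
    assume x: "x = [Min i l d, Cross (i + 1) t, Max i]"
    then have i: "i < length s" "s ! i = (l, \<not> d)" using kink_strand(2)[of i l d t s] s by auto
    show ?thesis
      by (rule that[of "u @ z" "length u" i t d, OF gr _ t _ ck])
        (use i lev c(2) x in \<open>auto simp: points_def kinked_def kink_def\<close>)
  qed
qed

lemma kinked_RI:
  assumes "diagram D" "(k, p) \<in> points D" "t \<noteq> Virtual"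
  shows "generalized_reidemeister D (kinked D k p r t)" "k + 1 \<in> RI_removable (kinked D k p r t)"
proof -
  let ?K = "kink (r = snd (level D k ! p)) p (level D k ! p) t"
  have k: "k \<le> length D" using assms(2) by (simp add: points_def)
  have "local_move RI [] ?K {}"
    using local_move_kink[of t "r = snd (level D k ! p)" p "level D k ! p"] assms(3) by simp
  then have mv: "move RI (take k D) (drop k D) [] ?K {}" 
    using assms(1) kinked_diagram[OF assms(1,2), of r t] by (simp add: move_def kinked_def)
  show "generalized_reidemeister D (kinked D k p r t)"
    unfolding generalized_reidemeister_def
    by (intro exI conjI, rule mv) (simp_all add: kinked_def)
  have "move RI (take k D) (drop k D) ?K [] {}" using move_sym[OF mv] by simp
  moreover have "k + 1 \<in> crossings (kinked D k p r t)"
    using k assms(3) by (auto simp: crossings_def kinked_def kink_def nth_append)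
  ultimately show "k + 1 \<in> RI_removable (kinked D k p r t)"
    using k unfolding RI_removable_def kinked_def by (fastforce simp: span_def)
qed

section \<open>Kinks in different virtual links of one flat link\<close>

lemma generalized_reidemeister_sym: "generalized_reidemeister D D' \<Longrightarrow> generalized_reidemeister D' D"
  unfolding generalized_reidemeister_def using move_sym by blast

lemma virtual_equiv_sym: "virtual_equiv D D' \<Longrightarrow> virtual_equiv D' D"
  unfolding virtual_equiv_def by (metis generalized_reidemeister_sym sympI sympD symp_rtranclp)

lemma flat_step_sym: "flat_step D D' \<Longrightarrow> flat_step D' D"
  unfolding flat_step_def using generalized_reidemeister_sym crossing_change_twice crossings_change
      by metis

lemma flat_equiv_sym: "flat_equiv D D' \<Longrightarrow> flat_equiv D' D"
  unfolding flat_equiv_def by (metis flat_step_sym sympI sympD symp_rtranclp)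

text \<open>Take the kink off \<open>D\<close>, deform the remaining \<open>D0\<close> into
  \<open>D1\<close> and carry the kink along. All crossing changes are spent on the way from
  \<open>D0\<close> to \<open>D1\<close>, so \<open>D2\<close>, which is \<open>D1\<close> with the
  kink, is one RI move away from \<open>D1\<close>.\<close>

lemma RI_removable_transfer:
  assumes "c \<in> RI_removable D" "flat_equiv D D1" "diagram D1"
  obtains D2 c2 where "virtual_equiv D1 D2" "c2 \<in> RI_removable D2" "track\<^sup>*\<^sup>* (D, c) (D2, c2)"
proof -
  obtain D0 k p r t where D0: "generalized_reidemeister D D0" "(k, p) \<in> points D0" "t \<noteq> Virtual"
    "D = kinked D0 k p r t" "c = k + 1" using RI_removable_kinked[OF assms(1)] .
  have "flat_step D0 D" using D0(1) generalized_reidemeister_sym by (auto simp: flat_step_def)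
  then have "flat_equiv D0 D1" using assms(2) unfolding flat_equiv_def by (rule
      converse_rtranclp_into_rtranclp)
  then obtain k' p' where kp': "(k', p') \<in> points D1" "track\<^sup>*\<^sup>* (D, c) (kinked D1 k'
      p' r t, k' + 1)"
    using flat_equiv_kinked[OF _ D0(2,3), of D1 r] D0(4,5) by blast
  show ?thesis
    using that[OF _ kinked_RI(2)[OF assms(3) kp'(1) D0(3)] kp'(2)] kinked_RI(1)[OF assms(3) kp'(1)
        D0(3), of r]
    by (auto simp: virtual_equiv_def)
qed

subsection \<open>Weights\<close>

lemma classical_event_shift [simp]: "classical_event (shift n e) = classical_event e"
  by (cases e) auto

lemma classical_flip_event [simp]: "classical_event (flip_event e) = classical_event e"
  by (cases e) auto

text \<open>A classical crossing of the fragment survives only in isotopies, RIII and SV. Thus (C1),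
  (C2) and (C3) together cover every crossing that survives a move.\<close>

lemma local_move_matching:
  assumes "local_move m x y K" "(a, b) \<in> K"
  shows "a < length x \<and> b < length y \<and> classical_event (x ! a) = classical_event (y ! b) \<and>
    (classical_event (x ! a) \<longrightarrow> m \<in> {Iso, RIII, SV})"
  using assms by cases (auto elim: triangle.cases)

lemma move_matching:
  assumes "move m u z x y K" "(a, b) \<in> K"
  shows "a < length x \<and> b < length y \<and> classical_event (x ! a) = classical_event (y ! b) \<and>
    (classical_event (x ! a) \<longrightarrow> m \<in> {Iso, RIII, SV})"
  using assms local_move_matching[of m x y K a b] local_move_matching[of m y x "K\<inverse>" b a]
  by (auto simp: move_def)

lemma corr_crossings:
  assumes "move m u z x y K" "(c, c') \<in> corr u x y K"
  shows "c \<in> crossings (u @ x @ z) \<longleftrightarrow> c' \<in> crossings (u @ y @ z)"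
  using assms(2) move_matching[OF assms(1)] unfolding corr_iff
  by (elim disjE exE conjE) (fastforce simp: crossings_def nth_append)+

lemma weight_function_corr:
  assumes w: "weight_function \<D> A w" and A: "A \<subseteq> all_crossings \<D>" and D: "u @ x @ z \<in> \<D>"
    and mv: "move m u z x y K" and c: "(c, c') \<in> corr u x y K"
    and "(u @ x @ z, c) \<in> A" "(u @ y @ z, c') \<in> A"
  shows "w (u @ y @ z, c') = w (u @ x @ z, c)"
proof (cases "(c, c') \<in> uninvolved_corr m u x y K")
  case True
  then show ?thesis using w D mv assms(6,7) unfolding weight_function_def local_C1_def by blast
next
  case False
  then have inner: "(c, c') \<in> inner_corr u K" and m: "m \<noteq> Iso"
    using c by (auto simp: corr_def uninvolved_corr_def)
  then obtain a b where ab: "(a, b) \<in> K" "c = length u + a" by (auto simp: inner_corr_def)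
  have "c \<in> crossings (u @ x @ z)" using A assms(6) by (auto simp: all_crossings_def)
  then have "classical_event (x ! a)"
    using ab move_matching[OF mv ab(1)] by (simp add: crossings_def nth_append)
  then have "m = RIII \<or> m = SV" using move_matching[OF mv ab(1)] m by blast
  then show ?thesis
    using w D mv assms(6,7) inner unfolding weight_function_def triangle_preserved_def by blast
qed

lemma regularD:
  assumes "regular \<D>" "D \<in> \<D>"
  shows "diagram D" "generalized_reidemeister D D' \<Longrightarrow> D' \<in> \<D>"
    "k \<in> crossings D \<Longrightarrow> crossing_change D k \<in> \<D>"
  using assms by (auto simp: regular_def)

lemma regular_move:
  assumes "regular \<D>" "u @ x @ z \<in> \<D>" "move m u z x y K"
  shows "u @ y @ z \<in> \<D>"
  using regularD(2)[OF assms(1,2)] assms(3) unfolding generalized_reidemeister_def by blast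

lemma regular_flat_equiv:
  assumes "regular \<D>" "D \<in> \<D>" "flat_equiv D D'"
  shows "D' \<in> \<D>"
  using assms(3) unfolding flat_equiv_def
  by (induction rule: rtranclp_induct) (use assms(1,2) regularD in \<open>auto simp: flat_step_def\<close>)

lemma consistentD:
  assumes "consistent \<D> A"
  shows "A \<subseteq> all_crossings \<D>" "weight_function \<D> (all_crossings \<D>) (\<lambda>x. of_bool (x \<in> A) :: int)"
    "(D, a, b) \<in> RII_pairs \<D> \<Longrightarrow> a \<in> crossings D \<Longrightarrow> b \<in> crossings D \<Longrightarrow> (D, a) \<in> A \<longleftrightarrow> (D, b) \<in> A"
proof -
  show "A \<subseteq> all_crossings \<D>" "weight_function \<D> (all_crossings \<D>) (\<lambda>x. of_bool (x \<in> A) :: int)"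
    using assms by (auto simp: consistent_def even_weight_function_def)
  assume *: "(D, a, b) \<in> RII_pairs \<D>" "a \<in> crossings D" "b \<in> crossings D"
  then have "(D, a) \<in> all_crossings \<D> \<and> (D, b) \<in> all_crossings \<D>"
    by (auto simp: RII_pairs_def all_crossings_def)
  with * assms have "(of_bool ((D, b) \<in> A) :: int) = of_bool ((D, a) \<in> A)"
    unfolding consistent_def even_weight_function_def by blast
  then show "(D, a) \<in> A \<longleftrightarrow> (D, b) \<in> A" by (simp split: if_splits add: of_bool_def)
qed

text \<open>Membership in \<open>A\<close> is itself a weight defined on all crossings, so the lemma
  for weight functions applies to it.\<close>

lemma consistent_corr:
  assumes "regular \<D>" "consistent \<D> A" "u @ x @ z \<in> \<D>" "move m u z x y K" "(c, c') \<in> corr u x y K"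
  shows "(u @ y @ z, c') \<in> A \<longleftrightarrow> (u @ x @ z, c) \<in> A"
proof (cases "c \<in> crossings (u @ x @ z)")
  case True
  then have "(u @ x @ z, c) \<in> all_crossings \<D>" "(u @ y @ z, c') \<in> all_crossings \<D>"
    using assms(3) regular_move[OF assms(1,3,4)] corr_crossings[OF assms(4,5)] by (auto simp:
        all_crossings_def)
  from weight_function_corr[OF consistentD(2)[OF assms(2)] subset_refl assms(3-5) this]
  show ?thesis by (simp split: if_splits add: of_bool_def)
next
  case False
  then show ?thesis using corr_crossings[OF assms(4,5)] consistentD(1)[OF assms(2)]
    by (auto simp: all_crossings_def)
qed

lemma track_weight:
  assumes reg: "regular \<D>" and A: "consistent \<D> A" and w: "weight_function \<D> A w"
    and D: "D \<in> \<D>" and tr: "track (D, c) (D', c')"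
  shows "D' \<in> \<D> \<and> ((D', c') \<in> A \<longleftrightarrow> (D, c) \<in> A) \<and> ((D, c) \<in> A \<longrightarrow> w (D', c') = w (D, c))"
  using tr
proof cases
  case (move m u z x y K)
  note mv = D[unfolded move(1)] move(3,4)
  show ?thesis
    using regular_move[OF reg mv(1,2)] consistent_corr[OF reg A mv]
      weight_function_corr[OF w consistentD(1)[OF A] mv] move(1,2) by simp
next
  case (change k)
  have D': "D' \<in> \<D>" using regularD(3)[OF reg D] change by simp
  have mem: "(D', c) \<in> A \<longleftrightarrow> (D, c) \<in> A"
  proof (cases "c \<in> crossings D")
    case True
    then have "(D, c) \<in> all_crossings \<D> \<and> (D', c) \<in> all_crossings \<D>"
      using D D' change by (auto simp: all_crossings_def)
    then have "(of_bool ((D', c) \<in> A) :: int) = of_bool ((D, c) \<in> A)"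
      using consistentD(2)[OF A] D True change
      unfolding weight_function_def local_crossing_change_def by blast
    then show ?thesis by (simp split: if_splits add: of_bool_def)
  next
    case False
    then show ?thesis using consistentD(1)[OF A] change by (auto simp: all_crossings_def)
  qed
  moreover have "w (D', c) = w (D, c)" if "(D, c) \<in> A"
  proof -
    have "c \<in> crossings D" using that consistentD(1)[OF A] by (auto simp: all_crossings_def)
    then show ?thesis using w D change that mem
      unfolding weight_function_def local_crossing_change_def by blast
  qed
  ultimately show ?thesis using D' change by simp
qed

lemma tracks_weight:
  assumes reg: "regular \<D>" and A: "consistent \<D> A" and w: "weight_function \<D> A w"
    and D: "D \<in> \<D>" and tr: "track\<^sup>*\<^sup>* (D, c) (D', c')"
  shows "D' \<in> \<D> \<and> ((D', c') \<in> A \<longleftrightarrow> (D, c) \<in> A) \<and> ((D, c) \<in> A \<longrightarrow> w (D', c') = w (D, c))"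
  using tr
proof (induction rule: rtranclp_induct2)
  case (step D1 c1 D2 c2)
  then show ?case using track_weight[OF reg A w, of D1 c1 D2 c2] by auto
qed (use D in auto)

section \<open>Weight sums as sums over all events\<close>

lemma sum_lessThan_add: "(\<Sum>k<m + n. f k) = (\<Sum>k<m. f k) + (\<Sum>j<n. f (m + j))"
  for f :: "nat \<Rightarrow> 'a::comm_monoid_add"
  by (induction n) (simp_all add: add.assoc)

text \<open>With the default 0 the weight sum runs over all indices and splits along
  \<open>u\<close>, the fragment and \<open>z\<close>.\<close>

definition contribution ::
  "(drawing \<times> nat) set \<Rightarrow> (drawing \<times> nat \<Rightarrow> 'g::ab_group_add) \<Rightarrow> (drawing \<times> nat \<Rightarrow> 'h) \<Rightarrow> 'h
     \<Rightarrow> drawing \<Rightarrow> nat \<Rightarrow> 'g" where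
  "contribution A v w g D c = (if c \<in> crossings D \<and> (D, c) \<in> A \<and> w (D, c) = g then v (D, c) else 0)"

lemma weight_sum_contribution: "weight_sum A v w g D = (\<Sum>c<length D. contribution A v w g D c)"
  unfolding weight_sum_def contribution_def
  by (rule sum.mono_neutral_cong_left) (auto simp: crossings_def)

subsection \<open>Changing many crossings\<close>

text \<open>Covers the mirror image as well as the change of all crossings but one.\<close>

definition flip_at :: "nat set \<Rightarrow> drawing \<Rightarrow> drawing" where
  "flip_at S D = map (\<lambda>k. if k \<in> S then flip_event (D ! k) else D ! k) [0..<length D]"

lemma flip_at_insert: "k \<notin> S \<Longrightarrow> k < length D \<Longrightarrow> flip_at (insert
    k S) D = crossing_change (flip_at S D) k"
  by (rule nth_equalityI) (auto simp: flip_at_def crossing_change_def nth_list_update)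

lemma crossings_flip_at [simp]: "crossings (flip_at S D) = crossings D"
  by (auto simp: crossings_def flip_at_def split: if_splits)

lemma flip_event_nonclassical: "\<not> classical_event e \<Longrightarrow> flip_event e = e"
  by (cases e) auto

lemma mirror_flip_at: "mirror D = flip_at (crossings D) D"
  by (rule nth_equalityI) (auto simp: mirror_def flip_at_def crossings_def flip_event_nonclassical)

lemma finite_crossings: "finite (crossings D)"
  by (simp add: crossings_def)

lemma crossings_mirror [simp]: "crossings (mirror D) = crossings D"
  by (simp add: mirror_flip_at)

lemma mirror_crossing_change: "mirror (crossing_change D k) = crossing_change (mirror D) k"
proof (cases "k < length D")
  case True
  then show ?thesis by (simp add: mirror_def crossing_change_def map_update)
qed (simp add: mirror_def crossing_change_def list_update_beyond)

lemma triangle_flip: "Defs.triangle m t1 t2 t3 \<Longrightarrow> Defs.triangle m (flip t1) (flip t2) (flip t3)"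
  by (induction rule: triangle.induct) (auto intro: triangle.intros)

lemma flip_event_shift [simp]: "flip_event (shift n e) = shift n (flip_event e)"
  "pos (flip_event e) = pos e" "strands_above (flip_event e) = strands_above e"
  "strands_below (flip_event e) = strands_below e"
  by (cases e; simp)+

lemma local_move_mirror: "local_move m x y K \<Longrightarrow> local_move m (mirror x) (mirror y) K"
proof (induction rule: local_move.induct)
  case (exchange e f)
  then show ?case using local_move.exchange[of "flip_event e" "flip_event f"] by (simp add: mirror_def)
next
  case (triangle m t1 t2 t3 i)
  then show ?case using local_move.triangle[OF triangle_flip] by (simp add: mirror_def)
next
  case (kink_right m t i l d)
  then show ?case using local_move.kink_right[of m "flip t" i l d] by (simp add: mirror_def)
next
  case (kink_left m t i l d)
  then show ?case using local_move.kink_left[of m "flip t" i l d] by (simp add: mirror_def)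
next
  case (bigon m t i)
  then show ?case using local_move.bigon[of m "flip t" i] by (simp add: mirror_def)
next
  case (rotate_max i t)
  then show ?case using local_move.rotate_max[of i "flip t"] by (simp add: mirror_def)
next
  case (rotate_min i l d t)
  then show ?case using local_move.rotate_min[of i l d "flip t"] by (simp add: mirror_def)
next
  case (zigzag_right i l d)
  then show ?case using local_move.zigzag_right by (simp add: mirror_def)
next
  case (zigzag_left i l d)
  then show ?case using local_move.zigzag_left by (simp add: mirror_def)
qed

subsection \<open>Invariance of the weight sums\<close>

text \<open>The link and the condition on \<open>g\<close> enter only in the context below; until
  then lemmas on a single move assume that removable crossings contribute 0.\<close>

locale weights =
  fixes \<D> :: "drawing set"
    and C' C'' :: "(drawing \<times> nat) set"
    and v :: "drawing \<times> nat \<Rightarrow> 'g::ab_group_add"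
    and w :: "drawing \<times> nat \<Rightarrow> 'h::ab_group_add"
    and g :: 'h
  assumes reg: "regular \<D>"
    and C': "consistent \<D> C'"
    and C'': "consistent \<D> C''" and unaff: "unaffected_by_crossing_changes \<D> C''"
    and sub: "C'' \<subseteq> C'"
    and v: "odd_weight_function \<D> C' v"
    and w: "even_weight_function \<D> C'' w"
begin

abbreviation "val \<equiv> contribution C'' v w g"

lemma weight_function_v: "weight_function \<D> C' v" and weight_function_w: "weight_function \<D> C'' w"
  using v w by (auto simp: odd_weight_function_def even_weight_function_def)

lemma val_corr:
  assumes "u @ x @ z \<in> \<D>" "move m u z x y K" "(c, c') \<in> corr u x y K"
  shows "val (u @ y @ z) c' = val (u @ x @ z) c"
  using consistent_corr[OF reg C'' assms] consistent_corr[OF reg C' assms] corr_crossings[OF assms(2,3)]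
    weight_function_corr[OF weight_function_w consistentD(1)[OF C''] assms]
    weight_function_corr[OF weight_function_v consistentD(1)[OF C'] assms] sub
  by (auto simp: contribution_def)

text \<open>Since \<open>w\<close> and the membership in \<open>C''\<close> are even, either both
  crossings are counted or neither is.\<close>

lemma val_RII:
  assumes "(D, a, b) \<in> RII_pairs \<D>" "a \<in> crossings D" "b \<in> crossings D"
  shows "val D a + val D b = 0"
proof (cases "(D, a) \<in> C''")
  case True
  then have b: "(D, b) \<in> C''" using consistentD(3)[OF C'' assms] by simp
  have "w (D, b) = w (D, a)" using w assms(1) True b unfolding even_weight_function_def by blast
  moreover have "v (D, b) = - v (D, a)"
    using v assms(1) True b sub unfolding odd_weight_function_def by blast
  ultimately show ?thesis using True b assms by (simp add: contribution_def)
next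
  case False
  then show ?thesis using consistentD(3)[OF C'' assms] by (simp add: contribution_def)
qed

lemma val_nonclassical: "k < length x \<Longrightarrow> \<not> classical_event (x ! k)
    \<Longrightarrow> val (u @ x @ z) (length u + k) = 0"
  by (simp add: contribution_def crossings_def nth_append)

text \<open>In \<open>local_move\<close> a kink is always on the side of \<open>y\<close>, so the
  vanishing at removable crossings is required of that diagram alone.\<close>

lemma weight_sum_local_move:
  assumes lm: "local_move m x y K" and D: "u @ x @ z \<in> \<D>" and D': "u @ y @ z \<in> \<D>"
    and RI: "\<And>c. c \<in> RI_removable (u @ y @ z) \<Longrightarrow> val (u @ y @ z) c = 0"
  shows "weight_sum C'' v w g (u @ x @ z) = weight_sum C'' v w g (u @ y @ z)"
proof -
  let ?D = "u @ x @ z" and ?D' = "u @ y @ z"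
  have mv: "move m u z x y K" using lm regularD(1)[OF reg D] regularD(1)[OF reg D'] by (simp add:
      move_def)
  have out: "val ?D' k = val ?D k" if "k < length u" for k
    using that by (intro val_corr[OF D mv]) (simp add: corr_iff)
  have out': "val ?D' (length u + (length y + k)) = val ?D (length u + (length x + k))" for k
    by (rule val_corr[OF D mv]) (simp add: corr_iff add.assoc)
  have K: "val ?D' (length u + b) = val ?D (length u + a)" if "(a, b) \<in> K" for a b
    using that by (intro val_corr[OF D mv]) (auto simp: corr_iff)
  have zx: "val ?D (length u + a) = 0" if "a < length x" "\<not> classical_event (x ! a)" for a
    using val_nonclassical that .
  have zy: "val ?D' (length u + a) = 0" if "a < length y" "\<not> classical_event (y ! a)" for a
    using val_nonclassical that .
  have kink: "val ?D' (length u + 1) = 0" if "m = RI" "x = []" "length y = 3" 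
  proof (cases "length u + 1 \<in> crossings ?D'")
    case True
    have "move RI u z y [] (K\<inverse>)" using move_sym[OF mv] that by simp
    moreover have "length u + 1 \<in> span u y" using that(3) by (simp add: span_def)
    ultimately have "length u + 1 \<in> RI_removable ?D'" using True unfolding RI_removable_def by blast
    then show ?thesis by (rule RI)
  qed (simp add: contribution_def)
  \<comment> \<open>Outside the fragment the sums agree termwise. Inside it, surviving crossings are
    matched by \<open>K\<close>, non-classical events contribute 0, and what remains is a kink or a
    bigon.\<close>
  have "(\<Sum>j<length x. val ?D (length u + j)) = (\<Sum>j<length y. val ?D' (length u + j))"
    using lm
  proof cases
    case (exchange e f)
    then show ?thesis using K[of 0 1] K[of 1 0] by (simp add: numeral_2_eq_2 add.commute)
  next
    case (zigzag_right i l d)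
    then show ?thesis using zy[of 0] zy[of 1] by (simp add: numeral_2_eq_2)
  next
    case (zigzag_left i l d)
    then show ?thesis using zy[of 0] zy[of 1] by (simp add: numeral_2_eq_2)
  next
    case (rotate_max i t)
    then show ?thesis using K[of 0 0] zx[of 1] zy[of 1] by (simp add: numeral_2_eq_2)
  next
    case (rotate_min i l d t)
    then show ?thesis using K[of 1 1] zx[of 0] zy[of 0] by (simp add: numeral_2_eq_2)
  next
    case (kink_right t i l d)
    then show ?thesis using kink zy[of 0] zy[of 1] zy[of 2] by (cases "t = Virtual") (simp_all add:
        numeral_eq_Suc)
  next
    case (kink_left t i l d)
    then show ?thesis using kink zy[of 0] zy[of 1] zy[of 2] by (cases "t = Virtual") (simp_all add:
        numeral_eq_Suc)
  next
    case (bigon t i)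
    show ?thesis
    proof (cases "t = Virtual")
      case True
      then show ?thesis using bigon zy[of 0] zy[of 1] by (simp add: numeral_2_eq_2)
    next
      case False
      have "move RII u z y [] (K\<inverse>)" using move_sym[OF mv] bigon False by simp
      moreover have "length u \<in> span u y" "length u + 1 \<in> span u y" "length u \<noteq> length u + 1"
        using bigon by (simp_all add: span_def)
      ultimately have "(?D', length u, length u + 1) \<in> RII_pairs \<D>"
        using D' unfolding RII_pairs_def by blast
      moreover have "length u \<in> crossings ?D'" "length u + 1 \<in> crossings ?D'"
        using bigon False by (auto simp: crossings_def nth_append)
      ultimately have "val ?D' (length u) + val ?D' (length u + 1) = 0" by (rule val_RII)
      then show ?thesis using bigon by (simp add: numeral_2_eq_2)
    qed
  next
    case (triangle t1 t2 t3 i)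
    then show ?thesis using K[of 0 2] K[of 1 1] K[of 2 0] by (simp add: numeral_eq_Suc add_ac)
  qed
  then show ?thesis
    using out out' by (simp add: weight_sum_contribution sum_lessThan_add)
qed

lemma weight_sum_generalized_reidemeister:
  assumes "D \<in> \<D>" "generalized_reidemeister D D'"
    and "\<And>c. c \<in> RI_removable D \<Longrightarrow> val D c = 0" "\<And>c. c \<in> RI_removable D' \<Longrightarrow> val D' c = 0"
  shows "weight_sum C'' v w g D' = weight_sum C'' v w g D"
proof -
  obtain m u z x y K where mv: "move m u z x y K" and eq: "D = u @ x @ z" "D' = u @ y @ z"
    using assms(2) by (auto simp: generalized_reidemeister_def)
  have D': "D' \<in> \<D>" using regularD(2)[OF reg assms(1,2)] .
  from mv have "local_move m x y K \<or> local_move m y x (K\<inverse>)" by (simp add: move_def)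
  then show ?thesis
    using weight_sum_local_move[of m x y K u z] weight_sum_local_move[of m y x "K\<inverse>" u z] assms D'
    unfolding eq by metis
qed

text \<open>Proved by one crossing change at a time. The domain is stable at all crossings, but
  values are compared only outside \<open>S\<close>, as locality gives nothing at a changed
  crossing.\<close>

lemma flip_at_properties:
  assumes "D \<in> \<D>" "finite S" "S \<subseteq> crossings D"
  shows "flat_equiv D (flip_at S D) \<and> flip_at S D \<in> \<D> \<and>
    (\<forall>c \<in> crossings D. (flip_at S D, c) \<in> C'' \<longleftrightarrow> (D, c) \<in> C'') \<and>
    (\<forall>c. c \<notin> S \<longrightarrow> val (flip_at S D) c = val D c)"
  using assms(2,3)
proof (induction S rule: finite_induct)
  case empty
  have "flip_at {} D = D" by (simp add: flip_at_def map_nth)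
  then show ?case using assms(1) by (simp add: flat_equiv_def)
next
  case (insert k S)
  let ?E = "flip_at S D" and ?E' = "flip_at (insert k S) D"
  have k: "k \<in> crossings ?E" using insert by simp
  then have E': "?E' = crossing_change ?E k"
    using insert by (intro flip_at_insert) (auto simp: crossings_def)
  have E: "flat_equiv D ?E" "?E \<in> \<D>" "\<forall>c \<in> crossings D. (?E, c) \<in> C'' \<longleftrightarrow> (D, c) \<in> C''"
    "\<forall>c. c \<notin> S \<longrightarrow> val ?E c = val D c" using insert by auto
  have "flat_step ?E ?E'" using k E' by (auto simp: flat_step_def)
  then have "flat_equiv D ?E'" using E(1) unfolding flat_equiv_def by (rule
      rtranclp.rtrancl_into_rtrancl[rotated])
  moreover have "?E' \<in> \<D>" using regularD(3)[OF reg E(2) k] E' by simp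
  moreover have "\<forall>c \<in> crossings D. (?E', c) \<in> C'' \<longleftrightarrow> (D, c) \<in> C''"
    using unaff E(2,3) k unfolding unaffected_by_crossing_changes_def E' by simp
  moreover have "val ?E' c = val D c" if "c \<notin> insert k S" for c
  proof -
    have tr: "track (?E, c) (?E', c)" unfolding E' using k that by (intro track.change) auto
    have "val ?E' c = val ?E c"
      using track_weight[OF reg C'' weight_function_w E(2) tr] track_weight[OF reg C'
          weight_function_v E(2) tr] sub
      by (auto simp: contribution_def)
    then show ?thesis using E(4) that by simp
  qed
  ultimately show ?case by blast
qed

lemma mirror_properties:
  assumes "D \<in> \<D>"
  shows "flat_equiv D (mirror D)" "mirror D \<in> \<D>"
    "c \<in> crossings D \<Longrightarrow> (mirror D, c) \<in> C'' \<longleftrightarrow> (D, c) \<in> C''"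
  using flip_at_properties[OF assms finite_crossings subset_refl] mirror_flip_at[of D] by auto

text \<open>The second sum takes its domain at \<open>D\<close> but its weights at the mirror image;
  the stability of \<open>C''\<close> under crossing changes reconciles the two.\<close>

lemma flat_weight_sum_mirror:
  assumes "D \<in> \<D>"
  shows "flat_weight_sum C'' v w g D = weight_sum C'' v w g D + weight_sum C'' v w g (mirror D)"
proof -
  have "{c \<in> crossings D. (D, c) \<in> C'' \<and> mirror_weight w (D, c) = g} =
      {c \<in> crossings (mirror D). (mirror D, c) \<in> C'' \<and> w (mirror D, c) = g}"
    using mirror_properties(3)[OF assms] by (auto simp: mirror_weight_def)
  then show ?thesis by (simp add: flat_weight_sum_def weight_sum_def mirror_weight_def)
qed

lemma val_crossing_change:
  assumes "D \<in> \<D>" "k \<in> crossings D" "c \<noteq> k"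
  shows "val (crossing_change D k) c = val D c"
proof -
  have "flip_at {k} D = crossing_change D k"
    by (rule nth_equalityI) (auto simp: flip_at_def crossing_change_def nth_list_update)
  then show ?thesis using flip_at_properties[OF assms(1), of "{k}"] assms(2,3) by simp
qed

text \<open>
  Away from \<open>k\<close> the diagrams \<open>D\<close> changed at \<open>k\<close> and \<open>mirror D\<close> are opposite to each other, but they
  agree at \<open>k\<close>. So the crossing change swaps the contributions of \<open>k\<close> to the two sums.
\<close>

lemma val_mirror:
  assumes "D \<in> \<D>" "k \<in> crossings D"
  shows "val (mirror D) k = val (crossing_change D k) k"
proof -
  let ?D' = "crossing_change D k"
  have "k < length D" "classical_event (D ! k)" using assms(2) by (auto simp: crossings_def)
  then have "flip_at (crossings ?D' - {k}) ?D' = mirror D"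
    by (intro nth_equalityI)
      (auto simp: flip_at_def crossing_change_def nth_list_update mirror_def crossings_def
        flip_event_nonclassical)
  moreover have "?D' \<in> \<D>" using regularD(3)[OF reg assms] .
  ultimately show ?thesis
    using flip_at_properties[of ?D' "crossings ?D' - {k}"] finite_crossings[of ?D'] by auto
qed

lemma flat_weight_sum_crossing_change:
  assumes "D \<in> \<D>" "k \<in> crossings D"
  shows "flat_weight_sum C'' v w g (crossing_change D k) = flat_weight_sum C'' v w g D"
proof -
  let ?D' = "crossing_change D k"
  have D': "?D' \<in> \<D>" "k \<in> crossings ?D'" using regularD(3)[OF reg assms] assms(2) by auto
  have M: "mirror D \<in> \<D>" "k \<in> crossings (mirror D)" using mirror_properties(2)[OF
      assms(1)] assms(2) by auto
  have "val ?D' c + val (mirror ?D') c = val D c + val (mirror D) c" for c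
  proof (cases "c = k")
    case True
    then show ?thesis using val_mirror[OF assms] val_mirror[OF D'] by (simp add: add.commute)
  next
    case False
    then show ?thesis
      using val_crossing_change[OF assms False] val_crossing_change[OF M False]
      by (simp add: mirror_crossing_change)
  qed
  moreover have "length (mirror E) = length E" for E by (simp add: mirror_def)
  ultimately show ?thesis
    by (simp add: flat_weight_sum_mirror assms D'(1) weight_sum_contribution flip: sum.distrib)
qed

lemma generalized_reidemeister_mirror:
  assumes "D \<in> \<D>" "generalized_reidemeister D D'"
  shows "generalized_reidemeister (mirror D) (mirror D')"
proof -
  obtain m u z x y K where mv: "move m u z x y K" and eq: "D = u @ x @ z" "D' = u @ y @ z"
    using assms(2) by (auto simp: generalized_reidemeister_def)
  have "diagram (mirror D)" "diagram (mirror D')"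
    using mirror_properties(2) regularD(1)[OF reg] regularD(2)[OF reg assms] assms(1) by blast+
  then have "move m (mirror u) (mirror z) (mirror x) (mirror y) K"
    using mv local_move_mirror unfolding move_def eq by (auto simp: mirror_def)
  then show ?thesis
    unfolding generalized_reidemeister_def eq by (intro exI conjI) (assumption | simp add: mirror_def)+
qed

section \<open>Invariance for a given link\<close>

context
  fixes L :: "drawing set"
  assumes link: "L \<in> virtual_links" and meets: "L \<inter> \<D> \<noteq> {}"
    and R: "g \<notin> R_link \<D> C'' w L \<or> R_link \<D> C' v L = {0}"
begin

lemma link_closed:
  assumes "D \<in> L" "virtual_equiv D D'"
  shows "D' \<in> L"
proof -
  obtain E where "L = {D'. virtual_equiv E D'}" using link by (auto simp: virtual_links_def)
  with assms show ?thesis unfolding virtual_equiv_def by (auto intro: rtranclp_trans)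
qed

lemma link_subset: "L \<subseteq> \<D>"
proof
  fix D assume D: "D \<in> L"
  obtain E where E: "L = {D'. virtual_equiv E D'}" using link by (auto simp: virtual_links_def)
  obtain D0 where D0: "D0 \<in> L" "D0 \<in> \<D>" using meets by auto
  have "virtual_equiv D0 D"
    using D D0(1) virtual_equiv_sym[of E D0] unfolding E virtual_equiv_def by (auto intro:
        rtranclp_trans)
  then show "D \<in> \<D>"
    unfolding virtual_equiv_def
    by (induction rule: rtranclp_induct) (use D0(2) regularD(2)[OF reg] in auto)
qed

text \<open>A nonzero contribution would be carried to a removable crossing \<open>c2\<close> of a
  diagram of \<open>L\<close>, with the values of \<open>v\<close> and \<open>w\<close> preserved.
  This puts \<open>g\<close> into \<open>R(w,L)\<close> and a nonzero element into
  \<open>R(v,L)\<close>, against both alternatives.\<close>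

lemma val_RI_removable:
  assumes D: "D \<in> L" "flat_equiv D E" and c: "c \<in> RI_removable E"
  shows "val E c = 0"
proof (rule ccontr)
  assume nz: "val E c \<noteq> 0"
  have "D \<in> \<D>" using D(1) link_subset by auto
  then have E: "E \<in> \<D>" using regular_flat_equiv[OF reg _ D(2)] by simp
  obtain E2 c2 where E2: "virtual_equiv D E2" "c2 \<in> RI_removable E2" "track\<^sup>*\<^sup>* (E, c) (E2, c2)"
    using RI_removable_transfer[OF c flat_equiv_sym[OF D(2)] regularD(1)[OF reg \<open>D \<in> \<D>\<close>]] .
  have L: "E2 \<in> L \<inter> \<D>" using link_closed[OF D(1) E2(1)] link_subset by auto
  from nz have Ec: "(E, c) \<in> C''" "w (E, c) = g" "v (E, c) \<noteq> 0"
    by (auto simp: contribution_def split: if_splits)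
  have E2c: "(E2, c2) \<in> C''" "w (E2, c2) = g" "v (E2, c2) \<noteq> 0"
    using tracks_weight[OF reg C'' weight_function_w E E2(3)] tracks_weight[OF reg C'
        weight_function_v E E2(3)]
      Ec sub by auto
  have "g \<in> R_link \<D> C'' w L" using L E2(2) E2c by (auto simp: R_link_def R_diagram_def)
  moreover have "v (E2, c2) \<in> R_link \<D> C' v L"
    using L E2(2) E2c sub unfolding R_link_def R_diagram_def by blast
  ultimately show False using R E2c(3) by auto
qed

lemma weight_sum_invariant: "virtual_link_invariant L (weight_sum C'' v w g)"
  unfolding virtual_link_invariant_def
proof (intro ballI allI impI)
  fix D D' assume D: "D \<in> L" and eq: "virtual_equiv D D'"
  have refl: "flat_equiv E E" for E by (simp add: flat_equiv_def)
  from eq show "weight_sum C'' v w g D' = weight_sum C'' v w g D"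
    unfolding virtual_equiv_def
  proof (induction rule: rtranclp_induct)
    case (step D1 D2)
    have "D1 \<in> L" "D2 \<in> L"
      using link_closed[OF D] step.hyps unfolding virtual_equiv_def
      by (auto intro: rtranclp.rtrancl_into_rtrancl)
    then have "weight_sum C'' v w g D2 = weight_sum C'' v w g D1"
      using link_subset step.hyps(2) val_RI_removable[OF _ refl]
      by (intro weight_sum_generalized_reidemeister) auto
    with step.IH show ?case by simp
  qed simp
qed

lemma flat_weight_sum_invariant: "flat_virtual_link_invariant L (flat_weight_sum C'' v w g)"
  unfolding flat_virtual_link_invariant_def
proof (intro ballI allI impI)
  fix D D' assume D: "D \<in> L" and eq: "flat_equiv D D'"
  from eq show "flat_weight_sum C'' v w g D' = flat_weight_sum C'' v w g D"
    unfolding flat_equiv_def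
  proof (induction rule: rtranclp_induct)
    case (step D1 D2)
    have eqs: "flat_equiv D D1" "flat_equiv D D2"
      using step.hyps unfolding flat_equiv_def by (auto intro: rtranclp.rtrancl_into_rtrancl)
    have in_D: "D1 \<in> \<D>" "D2 \<in> \<D>"
      using regular_flat_equiv[OF reg] eqs D link_subset by blast+
    \<comment> \<open>Mirror images stay in the flat class of \<open>D\<close>, so removable
      crossings contribute 0 in them too.\<close>
    have mirror_eq: "flat_equiv D (mirror E)" if "flat_equiv D E" "E \<in> \<D>" for E
      using that(1) mirror_properties(1)[OF that(2)] unfolding flat_equiv_def by (rule rtranclp_trans)
    have "flat_weight_sum C'' v w g D2 = flat_weight_sum C'' v w g D1"
      using step.hyps(2) unfolding flat_step_def
    proof
      assume gr: "generalized_reidemeister D1 D2"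
      have "weight_sum C'' v w g D2 = weight_sum C'' v w g D1"
        using in_D(1) gr val_RI_removable[OF D eqs(1)] val_RI_removable[OF D eqs(2)]
        by (rule weight_sum_generalized_reidemeister)
      moreover have "weight_sum C'' v w g (mirror D2) = weight_sum C'' v w g (mirror D1)"
        using mirror_properties(2)[OF in_D(1)] generalized_reidemeister_mirror[OF in_D(1) gr]
          val_RI_removable[OF D mirror_eq[OF eqs(1) in_D(1)]] val_RI_removable[OF D mirror_eq[OF
              eqs(2) in_D(2)]]
        by (rule weight_sum_generalized_reidemeister)
      ultimately show ?thesis by (simp add: flat_weight_sum_mirror in_D)
    next
      assume "\<exists>k\<in>crossings D1. D2 = crossing_change D1 k"
      then show ?thesis using flat_weight_sum_crossing_change[OF in_D(1)] by blast
    qed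
    with step.IH show ?case by simp
  qed simp
qed

end

end

theorem theorem1:
  fixes \<D> :: "drawing set"
    and C' C'' :: "(drawing \<times> nat) set"
    and v :: "drawing \<times> nat \<Rightarrow> 'g::ab_group_add"
    and w :: "drawing \<times> nat \<Rightarrow> 'h::ab_group_add"
    and g :: 'h
    and L :: "drawing set"
  assumes "regular \<D>"
    and "consistent \<D> C'" and "unaffected_by_crossing_changes \<D> C'"
    and "consistent \<D> C''" and "unaffected_by_crossing_changes \<D> C''"
    and "C'' \<subseteq> C'"
    and "odd_weight_function \<D> C' v"
    and "even_weight_function \<D> C'' w"
    and "L \<in> virtual_links" and "L \<inter> \<D> \<noteq> {}"
    and "g \<notin> R_link \<D> C'' w L \<or> R_link \<D> C' v L = {0}"
  shows "virtual_link_invariant L (weight_sum C'' v w g) \<and>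
    flat_virtual_link_invariant L (flat_weight_sum C'' v w g)"
proof -
  interpret weights \<D> C' C'' v w g
    using assms by unfold_locales
  show ?thesis using weight_sum_invariant flat_weight_sum_invariant assms(9-11) by blast
qed

end
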